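(* Let $A=\sigma(R)\langle x_1,\dots,x_n\rangle$ be a quasi-commutative bijective $\sigma$-PBW extension of $R$ (under the standing assumptions below). Let $M\neq0$ be a submodule of $A^m$ and let $G$ be a finite set of nonzero generators of $M$. Then $G$ is a Gröbner basis of $M$ if and only if for every $F=\{\mathbf g_1,\dots,\mathbf g_s\}\subseteq G$ with $\mathbf X_F\neq\mathbf 0$ and every $(b_1,\dots,b_s)\in B_F$ we have $\sum_{i=1}^sb_ix^{\gamma_i}\mathbf g_i\xrightarrow{G}_+\mathbf 0$.
   Context: Let $R\subseteq A$ be rings. $A$ is a $\sigma$-PBW extension of $R$, written $A=\sigma(R)\langle x_1,\dots,x_n\rangle$, if there are $x_1,\dots,x_n\in A\setminus R$ such that: (i) $A$ is a free left $R$-module with basis $\mathrm{Mon}(A)=\{x^\alpha=x_1^{\alpha_1}\cdots x_n^{\alpha_n}:\alpha\in\mathbb N^n\}$, with $x^0=1$; (ii) for every $i$ and every $r\in R\setminus\{0\}$ there is $c_{i,r}\in R\setminus\{0\}$ with $x_ir-c_{i,r}x_i\in R$; (iii) for all $i,j$ there is $c_{i,j}\in R\setminus\{0\}$ with $x_jx_i-c_{i,j}x_ix_j\in R+Rx_1+\dots+Rx_n$. There are injective ring endomorphisms $\sigma_i$ of $R$ and $\sigma_i$-derivations $\delta_i$ with $x_ir=\sigma_i(r)x_i+\delta_i(r)$. Write $\sigma^\alpha=\sigma_1^{\alpha_1}\circ\cdots\circ\sigma_n^{\alpha_n}$ and $|\alpha|=\sum\alpha_i$. For $\alpha,\beta$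 there are unique $c_{\alpha,\beta}\in R$ (left invertible) and $p_{\alpha,\beta}\in A$ with $x^\alpha x^\beta=c_{\alpha,\beta}x^{\alpha+\beta}+p_{\alpha,\beta}$, where $p_{\alpha,\beta}=0$ or $\deg p_{\alpha,\beta}<|\alpha+\beta|$. $A$ is quasi-commutative if $x_ir=c_{i,r}x_i$ and $x_jx_i=c_{i,j}x_ix_j$ exactly. $A$ is bijective if each $\sigma_i$ is bijective and $c_{i,j}$ is invertible for $i<j$. Standing assumptions: $R$ is left Gröbner soluble (left Noetherian; left ideal membership decidable with computable coefficients; finite generating sets of $\mathrm{Syz}_R[r_1\cdots r_k]=\{(b_1,\dots,b_k)\in R^k:\sum b_ir_i=0\}$ computable). $\mathrm{Mon}(A)$ carries a monomial order, i.e. a total order $\succeq$ with: (a) $x^\beta\succeq x^\alpha\Rightarrow lm(x^\gamma x^\beta x^\lambda)\succeq lm(x^\gamma x^\alpha x^\lambda)$; (b) $x^\alpha\succeq1$; (c) $|\beta|\ge|\alpha|\Rightarrow x^\beta\succeq x^\alpha$. $A^m$ is the free left $A$-module of column vectors with canonical basis $\mathbf e_i$. Monomials of $A^m$ are $x^\alpha\mathbf e_i$, with $\mathrm{ind}=i$, $\exp=\alpha$, $\deg=|\alpha|$. The monomial $x^\alpha\mathbf e_i$ divides $x^\beta\mathbf e_j$ iff $i=j$ and $\beta_k\ge\alpha_k$ for all $k$. The lcm of $x^\alpha\mathbf e_i$ and $x^\beta\mathbf e_j$ is $\mathbf 0$ if $i\neq j$, and $x^\gamma\mathbf e_i$ with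 $\gamma_k=\max(\alpha_k,\beta_k)$ if $i=j$. $\mathrm{Mon}(A^m)$ carries a monomial order, i.e. a total order with: (i) $lm(x^\beta x^\alpha)\mathbf e_i\succeq x^\alpha\mathbf e_i$; (ii) $x^\beta\mathbf e_j\succeq x^\alpha\mathbf e_i\Rightarrow lm(x^\gamma x^\beta)\mathbf e_j\succeq lm(x^\gamma x^\alpha)\mathbf e_i$; (iii) $\deg\mathbf X\ge\deg\mathbf Y\Rightarrow\mathbf X\succeq\mathbf Y$. For nonzero $\mathbf f=c_1\mathbf X_1+\dots+c_t\mathbf X_t$ with $c_i\in R\setminus\{0\}$ and $\mathbf X_1\succ\dots\succ\mathbf X_t$, set $lm(\mathbf f)=\mathbf X_1$, $lc(\mathbf f)=c_1$, $lt(\mathbf f)=c_1\mathbf X_1$. Also $lm(\mathbf 0)=\mathbf 0$ and $\mathbf X\succ\mathbf 0$. Reduction. Let $F$ be a finite set of nonzero vectors and $\mathbf f,\mathbf h\in A^m$. We write $\mathbf f\xrightarrow{F}\mathbf h$ (one step) if there are $\mathbf f_1,\dots,\mathbf f_t\in F$ and $r_1,\dots,r_t\in R$ with: (1) $lm(\mathbf f_i)\mid lm(\mathbf f)$, with $\alpha_i+\exp(lm\,\mathbf f_i)=\exp(lm\,\mathbf f)$; (2) $lc(\mathbf f)=\sum r_i\sigma^{\alpha_i}(lc\,\mathbf f_i)c_{\alpha_i,\exp(lm\,\mathbf f_i)}$; (3) $\mathbf h=\mathbf f-\sum r_ix^{\alpha_i}\mathbf f_i$. By convention $\mathbf 0\xrightarrow{F}\mathbf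 0$. $\mathbf f\xrightarrow{F}_+\mathbf h$ means a finite chain of one-step reductions from $\mathbf f$ to $\mathbf h$. $\mathbf f$ is reduced w.r.t. $F$ if $\mathbf f=\mathbf 0$ or no one-step reduction of $\mathbf f$ exists; otherwise it is reducible. Gröbner basis. For a submodule $M\neq0$ of $A^m$, a nonempty finite set $G$ of nonzero vectors of $M$ is a Gröbner basis for $M$ if every nonzero $\mathbf f\in M$ is reducible w.r.t. $G$. Syzygy data. For $F=\{\mathbf g_1,\dots,\mathbf g_s\}\subseteq A^m$: - $\mathbf X_F=\mathrm{lcm}\{lm(\mathbf g_1),\dots,lm(\mathbf g_s)\}$; - $\beta_i=\exp(lm\,\mathbf g_i)$; - when $\mathbf X_F\neq\mathbf 0$, $\gamma_i\in\mathbb N^n$ is defined by $\gamma_i+\beta_i=\exp(\mathbf X_F)$. $B_F$ is a finite generating set of the left $R$-module $\mathrm{Syz}_R\big[\sigma^{\gamma_1}(lc\,\mathbf g_1)c_{\gamma_1,\beta_1}\ \cdots\ \sigma^{\gamma_s}(lc\,\mathbf g_s)c_{\gamma_s,\beta_s}\big]$.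
   Formalization: Conditions (c) and (iii) on the monomial orders are taken in strict form (|β|>|α| implies x^β≻x^α, and likewise deg X>deg Y implies X≻Y), since with ≥ they contradict antisymmetry when n≥2 or m≥2; of the conditions on R only left Noetherian is assumed. *)

theory Defs
  imports Main
begin

text \<open>The ring A is the type 'a (a ring_1); R is a subring given as a set;
  the variables x_1..x_n are x 0, ..., x (n-1). Exponents alpha in N^n are
  functions nat => nat vanishing from n on. Vectors of A^m are functions
  nat => 'a supported on {1..m}.\<close>

definition exps :: "nat \<Rightarrow> (nat \<Rightarrow> nat) set" where
  "exps n = {\<alpha>. \<forall>i\<ge>n. \<alpha> i = 0}"

definition deg :: "nat \<Rightarrow> (nat \<Rightarrow> nat) \<Rightarrow> nat" where
  "deg n \<alpha> = (\<Sum>i<n. \<alpha> i)"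

definition eadd :: "(nat \<Rightarrow> nat) \<Rightarrow> (nat \<Rightarrow> nat) \<Rightarrow> nat \<Rightarrow> nat" where
  "eadd \<alpha> \<beta> = (\<lambda>k. \<alpha> k + \<beta> k)"

definition unit_exp :: "nat \<Rightarrow> nat \<Rightarrow> nat" where
  "unit_exp i = (\<lambda>k. if k = i then 1 else 0)"

definition xmon :: "(nat \<Rightarrow> 'a::ring_1) \<Rightarrow> nat \<Rightarrow> (nat \<Rightarrow> nat) \<Rightarrow> 'a" where
  "xmon x n \<alpha> = prod_list (map (\<lambda>i. x i ^ \<alpha> i) [0..<n])"

definition subring :: "'a::ring_1 set \<Rightarrow> bool" where
  "subring R \<longleftrightarrow> 0 \<in> R \<and> 1 \<in> R \<and> (\<forall>a\<in>R. \<forall>b\<in>R. a + b \<in> R \<and> a - b \<in> R \<and> a * b \<in> R)"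

definition left_ideal :: "'a::ring_1 set \<Rightarrow> 'a set \<Rightarrow> bool" where
  "left_ideal R I \<longleftrightarrow> I \<subseteq> R \<and> 0 \<in> I \<and> (\<forall>a\<in>I. \<forall>b\<in>I. a + b \<in> I) \<and>
     (\<forall>r\<in>R. \<forall>a\<in>I. r * a \<in> I)"

definition left_noetherian :: "'a::ring_1 set \<Rightarrow> bool" where
  "left_noetherian R \<longleftrightarrow> (\<forall>I. left_ideal R I \<longrightarrow>
     (\<exists>S. finite S \<and> S \<subseteq> I \<and>
        I = {(\<Sum>s\<in>S. r s * s) | r. \<forall>s. r s \<in> R}))"

definition is_repr :: "'a::ring_1 set \<Rightarrow> (nat \<Rightarrow> 'a) \<Rightarrow> nat \<Rightarrow> ((nat \<Rightarrow> nat) \<Rightarrow> 'a) \<Rightarrow> 'a \<Rightarrow> bool" where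
  "is_repr R x n c a \<longleftrightarrow> (\<forall>\<alpha>. c \<alpha> \<in> R) \<and> (\<forall>\<alpha>. \<alpha> \<notin> exps n \<longrightarrow> c \<alpha> = 0) \<and>
     finite {\<alpha>. c \<alpha> \<noteq> 0} \<and> a = (\<Sum>\<alpha>\<in>{\<alpha>. c \<alpha> \<noteq> 0}. c \<alpha> * xmon x n \<alpha>)"

definition coef :: "'a::ring_1 set \<Rightarrow> (nat \<Rightarrow> 'a) \<Rightarrow> nat \<Rightarrow> 'a \<Rightarrow> (nat \<Rightarrow> nat) \<Rightarrow> 'a" where
  "coef R x n a = (THE c. is_repr R x n c a)"

definition sigma_PBW :: "'a::ring_1 set \<Rightarrow> (nat \<Rightarrow> 'a) \<Rightarrow> nat \<Rightarrow> bool" where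
  "sigma_PBW R x n \<longleftrightarrow> subring R \<and> (\<forall>i<n. x i \<notin> R) \<and>
     (\<forall>a. \<exists>!c. is_repr R x n c a) \<and>
     (\<forall>i<n. \<forall>r\<in>R - {0}. \<exists>c\<in>R - {0}. x i * r - c * x i \<in> R) \<and>
     (\<forall>i<n. \<forall>j<n. \<exists>c\<in>R - {0}. x j * x i - c * x i * x j \<in>
        {r0 + (\<Sum>k<n. rs k * x k) | r0 rs. r0 \<in> R \<and> (\<forall>k. rs k \<in> R)})"

definition quasi_commutative :: "'a::ring_1 set \<Rightarrow> (nat \<Rightarrow> 'a) \<Rightarrow> nat \<Rightarrow> bool" where
  "quasi_commutative R x n \<longleftrightarrow>
     (\<forall>i<n. \<forall>r\<in>R - {0}. \<exists>c\<in>R - {0}. x i * r = c * x i) \<and>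
     (\<forall>i<n. \<forall>j<n. \<exists>c\<in>R - {0}. x j * x i = c * x i * x j)"

text \<open>sigma_i(r) is the coefficient of x_i in x_i r (since x_i r = sigma_i(r) x_i + delta_i(r)).\<close>
definition sigma :: "'a::ring_1 set \<Rightarrow> (nat \<Rightarrow> 'a) \<Rightarrow> nat \<Rightarrow> nat \<Rightarrow> 'a \<Rightarrow> 'a" where
  "sigma R x n i r = coef R x n (x i * r) (unit_exp i)"

definition c_ij :: "'a::ring_1 set \<Rightarrow> (nat \<Rightarrow> 'a) \<Rightarrow> nat \<Rightarrow> nat \<Rightarrow> nat \<Rightarrow> 'a" where
  "c_ij R x n i j = coef R x n (x j * x i) (eadd (unit_exp i) (unit_exp j))"

definition bijective_PBW :: "'a::ring_1 set \<Rightarrow> (nat \<Rightarrow> 'a) \<Rightarrow> nat \<Rightarrow> bool" where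
  "bijective_PBW R x n \<longleftrightarrow> (\<forall>i<n. bij_betw (sigma R x n i) R R) \<and>
     (\<forall>i j. i < j \<and> j < n \<longrightarrow>
        (\<exists>d\<in>R. d * c_ij R x n i j = 1 \<and> c_ij R x n i j * d = 1))"

definition sigma_exp :: "'a::ring_1 set \<Rightarrow> (nat \<Rightarrow> 'a) \<Rightarrow> nat \<Rightarrow> (nat \<Rightarrow> nat) \<Rightarrow> 'a \<Rightarrow> 'a" where
  "sigma_exp R x n \<alpha> = foldr (\<lambda>i f. ((sigma R x n i) ^^ (\<alpha> i)) \<circ> f) [0..<n] id"

definition c_ab :: "'a::ring_1 set \<Rightarrow> (nat \<Rightarrow> 'a) \<Rightarrow> nat \<Rightarrow> (nat \<Rightarrow> nat) \<Rightarrow> (nat \<Rightarrow> nat) \<Rightarrow> 'a" where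
  "c_ab R x n \<alpha> \<beta> = coef R x n (xmon x n \<alpha> * xmon x n \<beta>) (eadd \<alpha> \<beta>)"

definition lmA :: "'a::ring_1 set \<Rightarrow> (nat \<Rightarrow> 'a) \<Rightarrow> nat \<Rightarrow> ((nat \<Rightarrow> nat) \<Rightarrow> (nat \<Rightarrow> nat) \<Rightarrow> bool)
   \<Rightarrow> 'a \<Rightarrow> nat \<Rightarrow> nat" where
  "lmA R x n leA a = (THE \<alpha>. coef R x n a \<alpha> \<noteq> 0 \<and> (\<forall>\<beta>. coef R x n a \<beta> \<noteq> 0 \<longrightarrow> leA \<beta> \<alpha>))"

definition monomial_order_A :: "'a::ring_1 set \<Rightarrow> (nat \<Rightarrow> 'a) \<Rightarrow> nat
   \<Rightarrow> ((nat \<Rightarrow> nat) \<Rightarrow> (nat \<Rightarrow> nat) \<Rightarrow> bool) \<Rightarrow> bool" where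
  "monomial_order_A R x n leA \<longleftrightarrow>
     (\<forall>\<alpha>\<in>exps n. leA \<alpha> \<alpha>) \<and>
     (\<forall>\<alpha>\<in>exps n. \<forall>\<beta>\<in>exps n. leA \<alpha> \<beta> \<and> leA \<beta> \<alpha> \<longrightarrow> \<alpha> = \<beta>) \<and>
     (\<forall>\<alpha>\<in>exps n. \<forall>\<beta>\<in>exps n. \<forall>\<gamma>\<in>exps n. leA \<alpha> \<beta> \<and> leA \<beta> \<gamma> \<longrightarrow> leA \<alpha> \<gamma>) \<and>
     (\<forall>\<alpha>\<in>exps n. \<forall>\<beta>\<in>exps n. leA \<alpha> \<beta> \<or> leA \<beta> \<alpha>) \<and>
     (\<forall>\<alpha>\<in>exps n. \<forall>\<beta>\<in>exps n. \<forall>\<gamma>\<in>exps n. \<forall>\<delta>\<in>exps n. leA \<alpha> \<beta> \<longrightarrow>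
        leA (lmA R x n leA (xmon x n \<gamma> * xmon x n \<alpha> * xmon x n \<delta>))
            (lmA R x n leA (xmon x n \<gamma> * xmon x n \<beta> * xmon x n \<delta>))) \<and>
     (\<forall>\<alpha>\<in>exps n. leA (\<lambda>_. 0) \<alpha>) \<and>
     (\<forall>\<alpha>\<in>exps n. \<forall>\<beta>\<in>exps n. deg n \<alpha> < deg n \<beta> \<longrightarrow> leA \<alpha> \<beta> \<and> \<alpha> \<noteq> \<beta>)"

text \<open>Monomials of A^m are pairs (alpha, i) standing for x^alpha e_i, 1 <= i <= m.\<close>
definition monomial_order_m :: "'a::ring_1 set \<Rightarrow> (nat \<Rightarrow> 'a) \<Rightarrow> nat
   \<Rightarrow> ((nat \<Rightarrow> nat) \<Rightarrow> (nat \<Rightarrow> nat) \<Rightarrow> bool) \<Rightarrow> nat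
   \<Rightarrow> ((nat \<Rightarrow> nat) \<times> nat \<Rightarrow> (nat \<Rightarrow> nat) \<times> nat \<Rightarrow> bool) \<Rightarrow> bool" where
  "monomial_order_m R x n leA m leM \<longleftrightarrow>
     (let Mon = exps n \<times> {1..m} in
     (\<forall>X\<in>Mon. leM X X) \<and>
     (\<forall>X\<in>Mon. \<forall>Y\<in>Mon. leM X Y \<and> leM Y X \<longrightarrow> X = Y) \<and>
     (\<forall>X\<in>Mon. \<forall>Y\<in>Mon. \<forall>Z\<in>Mon. leM X Y \<and> leM Y Z \<longrightarrow> leM X Z) \<and>
     (\<forall>X\<in>Mon. \<forall>Y\<in>Mon. leM X Y \<or> leM Y X) \<and>
     (\<forall>\<alpha>\<in>exps n. \<forall>\<beta>\<in>exps n. \<forall>i\<in>{1..m}.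
        leM (\<alpha>, i) (lmA R x n leA (xmon x n \<beta> * xmon x n \<alpha>), i)) \<and>
     (\<forall>\<alpha>\<in>exps n. \<forall>\<beta>\<in>exps n. \<forall>\<gamma>\<in>exps n. \<forall>i\<in>{1..m}. \<forall>j\<in>{1..m}.
        leM (\<alpha>, i) (\<beta>, j) \<longrightarrow>
        leM (lmA R x n leA (xmon x n \<gamma> * xmon x n \<alpha>), i)
            (lmA R x n leA (xmon x n \<gamma> * xmon x n \<beta>), j)) \<and>
     (\<forall>X\<in>Mon. \<forall>Y\<in>Mon. deg n (fst X) < deg n (fst Y) \<longrightarrow> leM X Y \<and> X \<noteq> Y))"

definition vecs :: "nat \<Rightarrow> (nat \<Rightarrow> 'a::ring_1) set" where
  "vecs m = {f. \<forall>k. k \<notin> {1..m} \<longrightarrow> f k = 0}"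

definition zvec :: "nat \<Rightarrow> 'a::ring_1" where
  "zvec = (\<lambda>_. 0)"

definition suppv :: "'a::ring_1 set \<Rightarrow> (nat \<Rightarrow> 'a) \<Rightarrow> nat \<Rightarrow> nat \<Rightarrow> (nat \<Rightarrow> 'a)
   \<Rightarrow> ((nat \<Rightarrow> nat) \<times> nat) set" where
  "suppv R x n m f = {(\<alpha>, i). i \<in> {1..m} \<and> coef R x n (f i) \<alpha> \<noteq> 0}"

definition lmv :: "'a::ring_1 set \<Rightarrow> (nat \<Rightarrow> 'a) \<Rightarrow> nat \<Rightarrow> nat
   \<Rightarrow> ((nat \<Rightarrow> nat) \<times> nat \<Rightarrow> (nat \<Rightarrow> nat) \<times> nat \<Rightarrow> bool) \<Rightarrow> (nat \<Rightarrow> 'a)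
   \<Rightarrow> (nat \<Rightarrow> nat) \<times> nat" where
  "lmv R x n m leM f = (THE X. X \<in> suppv R x n m f \<and> (\<forall>Y\<in>suppv R x n m f. leM Y X))"

definition lcv :: "'a::ring_1 set \<Rightarrow> (nat \<Rightarrow> 'a) \<Rightarrow> nat \<Rightarrow> nat
   \<Rightarrow> ((nat \<Rightarrow> nat) \<times> nat \<Rightarrow> (nat \<Rightarrow> nat) \<times> nat \<Rightarrow> bool) \<Rightarrow> (nat \<Rightarrow> 'a) \<Rightarrow> 'a" where
  "lcv R x n m leM f = coef R x n (f (snd (lmv R x n m leM f))) (fst (lmv R x n m leM f))"

definition red :: "'a::ring_1 set \<Rightarrow> (nat \<Rightarrow> 'a) \<Rightarrow> nat \<Rightarrow> nat
   \<Rightarrow> ((nat \<Rightarrow> nat) \<times> nat \<Rightarrow> (nat \<Rightarrow> nat) \<times> nat \<Rightarrow> bool)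
   \<Rightarrow> (nat \<Rightarrow> 'a) set \<Rightarrow> (nat \<Rightarrow> 'a) \<Rightarrow> (nat \<Rightarrow> 'a) \<Rightarrow> bool" where
  "red R x n m leM F f h \<longleftrightarrow>
     (f = zvec \<and> h = zvec) \<or>
     (f \<noteq> zvec \<and>
      (\<exists>(t::nat) fs rs als.
         (\<forall>i<t. fs i \<in> F \<and> rs i \<in> R \<and>
            snd (lmv R x n m leM (fs i)) = snd (lmv R x n m leM f) \<and>
            (\<forall>k. als i k + fst (lmv R x n m leM (fs i)) k = fst (lmv R x n m leM f) k)) \<and>
         lcv R x n m leM f =
           (\<Sum>i<t. rs i * sigma_exp R x n (als i) (lcv R x n m leM (fs i))
                     * c_ab R x n (als i) (fst (lmv R x n m leM (fs i)))) \<and>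
         h = (\<lambda>k. f k - (\<Sum>i<t. rs i * xmon x n (als i) * fs i k))))"

definition red_plus :: "'a::ring_1 set \<Rightarrow> (nat \<Rightarrow> 'a) \<Rightarrow> nat \<Rightarrow> nat
   \<Rightarrow> ((nat \<Rightarrow> nat) \<times> nat \<Rightarrow> (nat \<Rightarrow> nat) \<times> nat \<Rightarrow> bool)
   \<Rightarrow> (nat \<Rightarrow> 'a) set \<Rightarrow> (nat \<Rightarrow> 'a) \<Rightarrow> (nat \<Rightarrow> 'a) \<Rightarrow> bool" where
  "red_plus R x n m leM F = tranclp (red R x n m leM F)"

definition reducible :: "'a::ring_1 set \<Rightarrow> (nat \<Rightarrow> 'a) \<Rightarrow> nat \<Rightarrow> nat
   \<Rightarrow> ((nat \<Rightarrow> nat) \<times> nat \<Rightarrow> (nat \<Rightarrow> nat) \<times> nat \<Rightarrow> bool)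
   \<Rightarrow> (nat \<Rightarrow> 'a) set \<Rightarrow> (nat \<Rightarrow> 'a) \<Rightarrow> bool" where
  "reducible R x n m leM F f \<longleftrightarrow> f \<noteq> zvec \<and> (\<exists>h. red R x n m leM F f h)"

definition is_Groebner_basis :: "'a::ring_1 set \<Rightarrow> (nat \<Rightarrow> 'a) \<Rightarrow> nat \<Rightarrow> nat
   \<Rightarrow> ((nat \<Rightarrow> nat) \<times> nat \<Rightarrow> (nat \<Rightarrow> nat) \<times> nat \<Rightarrow> bool)
   \<Rightarrow> (nat \<Rightarrow> 'a) set \<Rightarrow> (nat \<Rightarrow> 'a) set \<Rightarrow> bool" where
  "is_Groebner_basis R x n m leM M G \<longleftrightarrow>
     G \<noteq> {} \<and> finite G \<and> G \<subseteq> M \<and> zvec \<notin> G \<and>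
     (\<forall>f\<in>M. f \<noteq> zvec \<longrightarrow> reducible R x n m leM G f)"

definition span_A :: "(nat \<Rightarrow> 'a::ring_1) set \<Rightarrow> (nat \<Rightarrow> 'a) set" where
  "span_A G = {(\<lambda>k. \<Sum>g\<in>G. a g * g k) | a. True}"

text \<open>X_F is nonzero iff all leading monomials of F lie in the same component.\<close>
definition XF_nonzero :: "'a::ring_1 set \<Rightarrow> (nat \<Rightarrow> 'a) \<Rightarrow> nat \<Rightarrow> nat
   \<Rightarrow> ((nat \<Rightarrow> nat) \<times> nat \<Rightarrow> (nat \<Rightarrow> nat) \<times> nat \<Rightarrow> bool) \<Rightarrow> (nat \<Rightarrow> 'a) set \<Rightarrow> bool" where
  "XF_nonzero R x n m leM F \<longleftrightarrow>
     (\<forall>g\<in>F. \<forall>g'\<in>F. snd (lmv R x n m leM g) = snd (lmv R x n m leM g'))"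

definition exp_XF :: "'a::ring_1 set \<Rightarrow> (nat \<Rightarrow> 'a) \<Rightarrow> nat \<Rightarrow> nat
   \<Rightarrow> ((nat \<Rightarrow> nat) \<times> nat \<Rightarrow> (nat \<Rightarrow> nat) \<times> nat \<Rightarrow> bool) \<Rightarrow> (nat \<Rightarrow> 'a) set \<Rightarrow> nat \<Rightarrow> nat" where
  "exp_XF R x n m leM F = (\<lambda>k. Max ((\<lambda>g. fst (lmv R x n m leM g) k) ` F))"

definition gammaF :: "'a::ring_1 set \<Rightarrow> (nat \<Rightarrow> 'a) \<Rightarrow> nat \<Rightarrow> nat
   \<Rightarrow> ((nat \<Rightarrow> nat) \<times> nat \<Rightarrow> (nat \<Rightarrow> nat) \<times> nat \<Rightarrow> bool) \<Rightarrow> (nat \<Rightarrow> 'a) set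
   \<Rightarrow> (nat \<Rightarrow> 'a) \<Rightarrow> nat \<Rightarrow> nat" where
  "gammaF R x n m leM F g = (\<lambda>k. exp_XF R x n m leM F k - fst (lmv R x n m leM g) k)"

definition syz_entry :: "'a::ring_1 set \<Rightarrow> (nat \<Rightarrow> 'a) \<Rightarrow> nat \<Rightarrow> nat
   \<Rightarrow> ((nat \<Rightarrow> nat) \<times> nat \<Rightarrow> (nat \<Rightarrow> nat) \<times> nat \<Rightarrow> bool) \<Rightarrow> (nat \<Rightarrow> 'a) set
   \<Rightarrow> (nat \<Rightarrow> 'a) \<Rightarrow> 'a" where
  "syz_entry R x n m leM F g =
     sigma_exp R x n (gammaF R x n m leM F g) (lcv R x n m leM g)
       * c_ab R x n (gammaF R x n m leM F g) (fst (lmv R x n m leM g))"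

text \<open>Syz_R of the row (syz_entry g)_{g in F}; syzygies are indexed by the elements of F.\<close>
definition SyzF :: "'a::ring_1 set \<Rightarrow> (nat \<Rightarrow> 'a) \<Rightarrow> nat \<Rightarrow> nat
   \<Rightarrow> ((nat \<Rightarrow> nat) \<times> nat \<Rightarrow> (nat \<Rightarrow> nat) \<times> nat \<Rightarrow> bool) \<Rightarrow> (nat \<Rightarrow> 'a) set
   \<Rightarrow> ((nat \<Rightarrow> 'a) \<Rightarrow> 'a) set" where
  "SyzF R x n m leM F = {b. (\<forall>g. b g \<in> R) \<and> (\<forall>g. g \<notin> F \<longrightarrow> b g = 0) \<and>
      (\<Sum>g\<in>F. b g * syz_entry R x n m leM F g) = 0}"

definition finite_gen_set :: "'a::ring_1 set \<Rightarrow> ('b \<Rightarrow> 'a) set \<Rightarrow> ('b \<Rightarrow> 'a) set \<Rightarrow> bool" where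
  "finite_gen_set R B S \<longleftrightarrow> finite B \<and> B \<subseteq> S \<and>
     (\<forall>s\<in>S. \<exists>r. (\<forall>b. r b \<in> R) \<and> s = (\<lambda>g. \<Sum>b\<in>B. r b * b g))"

end

theory Submission
  imports Defs
begin

text \<open>
  In a bijective quasi-commutative extension \<open>x\<^sup>\<alpha> x\<^sup>\<beta>\<close> is a unit of \<open>R\<close> times \<open>x\<^bsup>\<alpha>+\<beta>\<^esup>\<close>,
  and \<open>x\<^sup>\<alpha> r = \<sigma>\<^sup>\<alpha>(r) x\<^sup>\<alpha>\<close> with \<open>\<sigma>\<^sup>\<alpha>\<close> a bijection of \<open>R\<close>. For a monomial \<open>X\<close>, consider the
  \<open>R\<close>-combinations of terms \<open>x\<^sup>\<alpha> g\<close> with \<open>g \<in> G\<close> and \<open>x\<^sup>\<alpha> lm(g) \<preceq> X\<close>; every element of \<open>M\<close> is one for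
  some \<open>X\<close>. If the coefficient of \<open>X\<close> in such a combination \<open>f\<close> is nonzero, then \<open>lm f = X\<close> and \<open>f\<close> is
  reducible. Otherwise the terms that reach \<open>X\<close> carry a syzygy of leading coefficients for the set \<open>F\<close> of
  all \<open>g\<close> whose leading monomial divides \<open>X\<close>. Writing \<open>X = x\<^sup>\<delta> X\<^sub>F\<close> up to a unit and pulling the
  coefficients back along \<open>\<sigma>\<^sup>\<delta>\<close> turns it into a member of the syzygy module spanned by \<open>B\<^sub>F\<close>. As the
  combinations attached to \<open>B\<^sub>F\<close> reduce to zero, they can be rewritten with terms strictly below
  \<open>X\<^sub>F\<close>, so \<open>f\<close> is a combination of terms strictly below \<open>X\<close>. Since only finitely many monomials lie below
  a given one, this descent stops.
\<close>

lemma zero_exps [simp]: "(\<lambda>_. 0) \<in> exps n"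
  and unit_exps [simp]: "i < n \<Longrightarrow> unit_exp i \<in> exps n"
  and eadd_exps: "\<alpha> \<in> exps n \<Longrightarrow> \<beta> \<in> exps n \<Longrightarrow> eadd \<alpha> \<beta> \<in> exps n"
  by (auto simp: exps_def unit_exp_def eadd_def)

lemma eadd_cancel: "eadd \<alpha> \<beta> = eadd \<alpha> \<gamma> \<longleftrightarrow> \<beta> = \<gamma>"
  by (auto simp: eadd_def fun_eq_iff)

lemma finite_exps_deg: "finite {\<alpha> \<in> exps n. deg n \<alpha> \<le> d}"
proof (rule finite_subset)
  show "{\<alpha> \<in> exps n. deg n \<alpha> \<le> d} \<subseteq>
    {f. \<forall>k. (k \<in> {..<n} \<longrightarrow> f k \<in> {..d}) \<and> (k \<notin> {..<n} \<longrightarrow> f k = 0)}"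
  proof (intro subsetI CollectI allI conjI impI)
    fix \<alpha> k assume a: "\<alpha> \<in> {\<alpha> \<in> exps n. deg n \<alpha> \<le> d}"
    then show "k \<in> {..<n} \<Longrightarrow> \<alpha> k \<in> {..d}"
      using member_le_sum[of k "{..<n}" \<alpha>] by (simp add: deg_def)
    show "k \<notin> {..<n} \<Longrightarrow> \<alpha> k = 0" using a by (simp add: exps_def)
  qed
qed (rule finite_set_of_finite_funs; simp)

lemma prod_list_one: "(\<And>y. y \<in> set ys \<Longrightarrow> f y = (1::'b::monoid_mult)) \<Longrightarrow> prod_list (map f ys) = 1"
  by (induction ys) auto

lemma upt_split: "i < n \<Longrightarrow> [0..<n] = [0..<i] @ i # [Suc i..<n]"
  using upt_add_eq_append[of 0 i "n - i"] upt_conv_Cons[of i n] by simp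

lemma xmon_zero [simp]: "xmon x n (\<lambda>_. 0) = 1"
  by (simp add: xmon_def map_replicate_const)

lemma xmon_eadd_unit_left:
  assumes "i < n" "\<And>k. k < i \<Longrightarrow> \<alpha> k = 0"
  shows "xmon x n (eadd (unit_exp i) \<alpha>) = x i * xmon x n \<alpha>"
proof -
  have 1: "prod_list (map (\<lambda>k. x k ^ eadd (unit_exp i) \<alpha> k) [0..<i]) = 1"
    "prod_list (map (\<lambda>k. x k ^ \<alpha> k) [0..<i]) = 1"
    by (rule prod_list_one, use assms in \<open>auto simp: eadd_def unit_exp_def\<close>)+
  have 2: "map (\<lambda>k. x k ^ eadd (unit_exp i) \<alpha> k) [Suc i..<n] = map (\<lambda>k. x k ^ \<alpha> k) [Suc i..<n]"
    by (auto simp: eadd_def unit_exp_def)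
  show ?thesis
    unfolding xmon_def upt_split[OF assms(1)] map_append list.map prod_list.append prod_list.Cons 1 2
    by (simp add: eadd_def unit_exp_def mult.assoc)
qed

lemma xmon_unit: "i < n \<Longrightarrow> xmon x n (unit_exp i) = x i"
  using xmon_eadd_unit_left[where \<alpha> = "\<lambda>_. 0"] by (simp add: eadd_def)

lemma span_A_add:
  assumes "v \<in> span_A G" "w \<in> span_A G"
  shows "(\<lambda>k. v k + w k) \<in> span_A G"
proof -
  obtain a b where "v = (\<lambda>k. \<Sum>g\<in>G. a g * g k)" "w = (\<lambda>k. \<Sum>g\<in>G. b g * g k)"
    using assms by (auto simp: span_A_def)
  then have "(\<lambda>k. v k + w k) = (\<lambda>k. \<Sum>g\<in>G. (a g + b g) * g k)"
    by (simp add: sum.distrib distrib_right)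
  then show ?thesis unfolding span_A_def by (intro CollectI exI[of _ "\<lambda>g. a g + b g"]) simp
qed

lemma span_A_diff:
  assumes "v \<in> span_A G" "w \<in> span_A G"
  shows "(\<lambda>k. v k - w k) \<in> span_A G"
proof -
  obtain a b where "v = (\<lambda>k. \<Sum>g\<in>G. a g * g k)" "w = (\<lambda>k. \<Sum>g\<in>G. b g * g k)"
    using assms by (auto simp: span_A_def)
  then have "(\<lambda>k. v k - w k) = (\<lambda>k. \<Sum>g\<in>G. (a g - b g) * g k)"
    by (simp add: sum_subtractf left_diff_distrib)
  then show ?thesis unfolding span_A_def by (intro CollectI exI[of _ "\<lambda>g. a g - b g"]) simp
qed

subsection \<open>Products of monomials\<close>

locale qc_bij_PBW =
  fixes R :: "'a::ring_1 set" and x :: "nat \<Rightarrow> 'a" and n :: nat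
  assumes pbw: "sigma_PBW R x n"
    and qc: "quasi_commutative R x n"
    and bij: "bijective_PBW R x n"
begin

abbreviation "cf \<equiv> coef R x n"
abbreviation "mon \<equiv> xmon x n"
abbreviation "sg \<equiv> sigma R x n"
abbreviation "sgx \<equiv> sigma_exp R x n"
abbreviation "cc \<equiv> c_ab R x n"

lemma R_closed:
  "0 \<in> R" "1 \<in> R"
  "a \<in> R \<Longrightarrow> b \<in> R \<Longrightarrow> a + b \<in> R"
  "a \<in> R \<Longrightarrow> b \<in> R \<Longrightarrow> a - b \<in> R"
  "a \<in> R \<Longrightarrow> b \<in> R \<Longrightarrow> a * b \<in> R"
  using pbw by (auto simp: sigma_PBW_def subring_def)

lemma is_repr_coef: "is_repr R x n (cf a) a"
proof -
  have "\<exists>!c. is_repr R x n c a" using pbw by (auto simp: sigma_PBW_def)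
  then show ?thesis unfolding coef_def by (rule theI')
qed

lemma coef_in_R [simp]: "cf a \<alpha> \<in> R"
  and coef_outside: "\<alpha> \<notin> exps n \<Longrightarrow> cf a \<alpha> = 0"
  and finite_coef [simp]: "finite {\<alpha>. cf a \<alpha> \<noteq> 0}"
  and coef_expansion: "a = (\<Sum>\<alpha>\<in>{\<alpha>. cf a \<alpha> \<noteq> 0}. cf a \<alpha> * mon \<alpha>)"
  using is_repr_coef[of a] by (auto simp: is_repr_def)

lemma coef_nonzero_exps: "cf a \<alpha> \<noteq> 0 \<Longrightarrow> \<alpha> \<in> exps n"
  using coef_outside by blast

lemma coef_eqI:
  assumes "\<And>\<alpha>. c \<alpha> \<in> R" "finite S" "S \<subseteq> exps n" "\<And>\<alpha>. \<alpha> \<notin> S \<Longrightarrow> c \<alpha> = 0"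
    and "a = (\<Sum>\<alpha>\<in>S. c \<alpha> * mon \<alpha>)"
  shows "cf a = c"
proof -
  have sub: "{\<alpha>. c \<alpha> \<noteq> 0} \<subseteq> S" using assms(4) by blast
  have "a = (\<Sum>\<alpha>\<in>{\<alpha>. c \<alpha> \<noteq> 0}. c \<alpha> * mon \<alpha>)"
    unfolding assms(5) by (rule sum.mono_neutral_right) (use sub assms(2) in auto)
  then have "is_repr R x n c a"
    unfolding is_repr_def using assms(1,3,4) sub assms(2) finite_subset by fastforce
  then show ?thesis
    using pbw is_repr_coef[of a] by (auto simp: sigma_PBW_def)
qed

lemma coef_expansion_superset:
  assumes "finite S" "{\<alpha>. cf a \<alpha> \<noteq> 0} \<subseteq> S"
  shows "a = (\<Sum>\<alpha>\<in>S. cf a \<alpha> * mon \<alpha>)"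
  by (rule trans[OF coef_expansion], rule sum.mono_neutral_left) (use assms in auto)

lemma coef_add: "cf (a + b) \<alpha> = cf a \<alpha> + cf b \<alpha>"
proof -
  let ?S = "{\<alpha>. cf a \<alpha> \<noteq> 0} \<union> {\<alpha>. cf b \<alpha> \<noteq> 0}"
  have "a + b = (\<Sum>\<alpha>\<in>?S. cf a \<alpha> * mon \<alpha>) + (\<Sum>\<alpha>\<in>?S. cf b \<alpha> * mon \<alpha>)"
    by (intro arg_cong2[where f = "(+)"] coef_expansion_superset) auto
  also have "\<dots> = (\<Sum>\<alpha>\<in>?S. (cf a \<alpha> + cf b \<alpha>) * mon \<alpha>)"
    by (simp add: sum.distrib distrib_right)
  finally have "cf (a + b) = (\<lambda>\<alpha>. cf a \<alpha> + cf b \<alpha>)"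
    by (intro coef_eqI[of _ ?S]) (auto simp: R_closed dest: coef_nonzero_exps)
  then show ?thesis by simp
qed

lemma coef_zero [simp]: "cf 0 \<alpha> = 0"
  using coef_add[of 0 0 \<alpha>] by simp

lemma coef_sum: "cf (sum f S) \<alpha> = (\<Sum>i\<in>S. cf (f i) \<alpha>)"
  by (induction S rule: infinite_finite_induct) (auto simp: coef_add)

lemma coef_diff: "cf (a - b) \<alpha> = cf a \<alpha> - cf b \<alpha>"
  by (metis add_diff_cancel_right' coef_add diff_add_cancel)

lemma coef_monomial:
  assumes "r \<in> R" "\<alpha> \<in> exps n"
  shows "cf (r * mon \<alpha>) \<beta> = (if \<beta> = \<alpha> then r else 0)"
proof -
  have "cf (r * mon \<alpha>) = (\<lambda>\<beta>. if \<beta> = \<alpha> then r else 0)"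
    by (rule coef_eqI[of _ "{\<alpha>}"]) (use assms in \<open>auto simp: R_closed\<close>)
  then show ?thesis by simp
qed

lemma monomial_coef_unique:
  assumes "r \<in> R" "s \<in> R" "\<alpha> \<in> exps n" "r * mon \<alpha> = s * mon \<alpha>"
  shows "r = s"
  by (metis assms coef_monomial)

lemma sigma_in_R [simp]: "sg i r \<in> R"
  by (simp add: sigma_def)

lemma x_mult_R:
  assumes "i < n" "r \<in> R"
  shows "x i * r = sg i r * x i"
proof (cases "r = 0")
  case True
  then show ?thesis by (simp add: sigma_def)
next
  case False
  then obtain c where c: "c \<in> R" "x i * r = c * x i"
    using qc assms unfolding quasi_commutative_def by blast
  then have "sg i r = c"
    using coef_monomial[of c "unit_exp i" "unit_exp i"] assms by (simp add: sigma_def xmon_unit)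
  with c show ?thesis by simp
qed

lemma sigma_bij: "i < n \<Longrightarrow> bij_betw (sg i) R R"
  using bij by (auto simp: bijective_PBW_def)

lemma sigma_eqI:
  assumes "i < n" "r \<in> R" "s \<in> R" "x i * r = s * x i"
  shows "sg i r = s"
  using monomial_coef_unique[of "sg i r" s "unit_exp i"] assms x_mult_R[of i r]
  by (simp add: xmon_unit)

lemma sigma_mult:
  assumes "i < n" "r \<in> R" "s \<in> R"
  shows "sg i (r * s) = sg i r * sg i s"
proof (rule sigma_eqI)
  have "x i * (r * s) = sg i r * (x i * s)"
    using x_mult_R[of i r] assms by (simp add: mult.assoc[symmetric])
  then show "x i * (r * s) = sg i r * sg i s * x i"
    using x_mult_R[of i s] assms by (simp add: mult.assoc)
qed (use assms in \<open>auto simp: R_closed\<close>)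

lemma sigma_one: "i < n \<Longrightarrow> sg i 1 = 1"
  by (rule sigma_eqI) (auto simp: R_closed)

lemma funpow_sigma:
  assumes "i < n" "r \<in> R"
  shows "(sg i ^^ k) r \<in> R \<and> x i ^ k * r = (sg i ^^ k) r * x i ^ k"
proof (induction k)
  case 0
  then show ?case using assms by simp
next
  case (Suc k)
  have "x i ^ Suc k * r = x i * ((sg i ^^ k) r) * x i ^ k" using Suc by (simp add: mult.assoc)
  also have "\<dots> = (sg i ^^ Suc k) r * x i ^ Suc k"
    using x_mult_R[OF assms(1)] Suc by (simp add: mult.assoc)
  finally show ?case by simp
qed

lemma foldr_sigma_Cons:
  "foldr (\<lambda>i f. (sg i ^^ \<alpha> i) \<circ> f) (i # L) id =
    (sg i ^^ \<alpha> i) \<circ> foldr (\<lambda>i f. (sg i ^^ \<alpha> i) \<circ> f) L id"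
  by simp

lemma foldr_sigma:
  assumes "set L \<subseteq> {..<n}" "r \<in> R"
  shows "foldr (\<lambda>i f. (sg i ^^ \<alpha> i) \<circ> f) L id r \<in> R \<and>
    prod_list (map (\<lambda>i. x i ^ \<alpha> i) L) * r =
      foldr (\<lambda>i f. (sg i ^^ \<alpha> i) \<circ> f) L id r * prod_list (map (\<lambda>i. x i ^ \<alpha> i) L)"
  using assms(1)
proof (induction L)
  case Nil
  then show ?case using assms by simp
next
  case (Cons i L)
  define s where "s = foldr (\<lambda>i f. (sg i ^^ \<alpha> i) \<circ> f) L id r"
  define p where "p = prod_list (map (\<lambda>i. x i ^ \<alpha> i) L)"
  have L: "set L \<subseteq> {..<n}" using Cons.prems by simp
  have IH: "s \<in> R" "p * r = s * p" using Cons.IH[OF L] unfolding s_def p_def by blast+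
  have f: "(sg i ^^ \<alpha> i) s \<in> R" "x i ^ \<alpha> i * s = (sg i ^^ \<alpha> i) s * x i ^ \<alpha> i"
    using funpow_sigma[of i s "\<alpha> i"] IH Cons.prems by auto
  have "x i ^ \<alpha> i * p * r = x i ^ \<alpha> i * s * p" using IH by (simp add: mult.assoc)
  also have "\<dots> = (sg i ^^ \<alpha> i) s * (x i ^ \<alpha> i * p)" using f by (simp add: mult.assoc)
  finally show ?case using f(1) unfolding foldr_sigma_Cons by (simp add: s_def[symmetric] p_def[symmetric])
qed

lemma sigma_exp_in_R [simp]: "r \<in> R \<Longrightarrow> sgx \<alpha> r \<in> R"
  and xmon_mult_R: "r \<in> R \<Longrightarrow> mon \<alpha> * r = sgx \<alpha> r * mon \<alpha>"
  using foldr_sigma[of "[0..<n]" r \<alpha>] by (simp_all add: sigma_exp_def xmon_def atLeast0LessThan)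

lemma sigma_exp_bij: "bij_betw (sgx \<alpha>) R R"
proof -
  have pow: "bij_betw (sg i ^^ k) R R" if "i < n" for i k
  proof (induction k)
    case 0
    then show ?case by (simp add: bij_betw_def)
  next
    case (Suc k)
    then show ?case using bij_betw_trans[OF Suc sigma_bij[OF that]] by (simp only: funpow.simps)
  qed
  have "bij_betw (foldr (\<lambda>i f. (sg i ^^ \<alpha> i) \<circ> f) L id) R R" if "set L \<subseteq> {..<n}" for L
    using that
  proof (induction L)
    case Nil
    then show ?case by (simp add: bij_betw_def)
  next
    case (Cons i L)
    then have L: "set L \<subseteq> {..<n}" and i: "i < n" by simp_all
    show ?case unfolding foldr_sigma_Cons by (rule bij_betw_trans[OF Cons.IH[OF L] pow[OF i]])
  qed
  from this[of "[0..<n]"] show ?thesis unfolding sigma_exp_def by (simp add: atLeast0LessThan)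
qed

lemma sigma_exp_eqI:
  assumes "\<alpha> \<in> exps n" "r \<in> R" "s \<in> R" "mon \<alpha> * r = s * mon \<alpha>"
  shows "sgx \<alpha> r = s"
  using monomial_coef_unique[of "sgx \<alpha> r" s \<alpha>] assms xmon_mult_R[of r \<alpha>] by simp

lemma sigma_exp_zero: "\<alpha> \<in> exps n \<Longrightarrow> sgx \<alpha> 0 = 0"
  by (rule sigma_exp_eqI) (auto simp: R_closed)

lemma sigma_exp_eq_zero:
  assumes "\<alpha> \<in> exps n" "r \<in> R" "sgx \<alpha> r = 0"
  shows "r = 0"
  using sigma_exp_bij[of \<alpha>] sigma_exp_zero[OF assms(1)] assms
  by (metis R_closed(1) bij_betw_inv_into_left)

definition units :: "'a set" where
  "units = {u \<in> R. \<exists>v\<in>R. u * v = 1 \<and> v * u = 1}"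

lemma units_in_R: "u \<in> units \<Longrightarrow> u \<in> R"
  by (simp add: units_def)

lemma one_units: "1 \<in> units"
  by (simp add: units_def R_closed)

lemma units_mult:
  assumes "u \<in> units" "v \<in> units"
  shows "u * v \<in> units"
proof -
  from assms obtain u' v' where "u' \<in> R" "v' \<in> R" "u * u' = 1" "u' * u = 1" "v * v' = 1" "v' * v = 1"
    "u \<in> R" "v \<in> R"
    by (auto simp: units_def)
  moreover from this have "u * v * (v' * u') = 1" "v' * u' * (u * v) = 1"
    by (metis mult.assoc mult.right_neutral)+
  ultimately show ?thesis unfolding units_def
    by (auto simp: R_closed intro!: bexI[of _ "v' * u'"])
qed

lemma units_inverse:
  assumes "u \<in> units"
  obtains v where "v \<in> units" "u * v = 1" "v * u = 1"
proof -
  from assms obtain v where "u \<in> R" "v \<in> R" "u * v = 1" "v * u = 1"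
    unfolding units_def by auto
  then show thesis by (intro that[of v]) (auto simp: units_def)
qed

lemma sigma_units:
  assumes "i < n" "u \<in> units"
  shows "sg i u \<in> units"
proof -
  obtain v where v: "v \<in> units" "u * v = 1" "v * u = 1" using units_inverse assms by blast
  then have "sg i u * sg i v = 1" "sg i v * sg i u = 1"
    using sigma_mult[OF assms(1)] sigma_one[OF assms(1)] units_in_R assms by metis+
  then show ?thesis by (auto simp: units_def)
qed

lemma x_commute_less:
  assumes "i < j" "j < n"
  shows "\<exists>u\<in>units. x j * x i = u * x i * x j"
proof -
  have i: "i < n" using assms by simp
  have "\<exists>c\<in>R - {0}. x j * x i = c * x i * x j"
    using conjunct2[OF qc[unfolded quasi_commutative_def]] assms(2) i by simp
  then obtain c where c: "c \<in> R" "x j * x i = c * x i * x j" by blast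
  have e: "mon (eadd (unit_exp i) (unit_exp j)) = x i * x j"
    using xmon_eadd_unit_left[OF i, of "unit_exp j" x] assms xmon_unit[OF assms(2), of x] by (simp add: unit_exp_def)
  have "c_ij R x n i j = c"
    unfolding c_ij_def c(2) mult.assoc e[symmetric]
    using coef_monomial[OF c(1)] assms by (simp add: eadd_exps)
  moreover obtain d where "d \<in> R" "d * c_ij R x n i j = 1" "c_ij R x n i j * d = 1"
    using bij assms unfolding bijective_PBW_def by blast
  ultimately have "c \<in> units" using c(1) by (auto simp: units_def)
  with c show ?thesis by blast
qed

lemma x_commute:
  assumes "i < n" "j < n"
  shows "\<exists>u\<in>units. x j * x i = u * x i * x j"
proof (cases i j rule: linorder_cases)
  case less
  then show ?thesis using x_commute_less assms by blast
next
  case equal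
  then show ?thesis using one_units by force
next
  case greater
  obtain u where u: "u \<in> units" "x i * x j = u * x j * x i" using x_commute_less[OF greater assms(1)] by blast
  obtain v where v: "v \<in> units" "v * u = 1" using units_inverse u(1) by metis
  have "v * x i * x j = v * (u * x j * x i)" using u(2) by (simp add: mult.assoc)
  also have "\<dots> = v * u * (x j * x i)" by (simp add: mult.assoc)
  finally have "x j * x i = v * x i * x j" by (simp add: v(2))
  with v show ?thesis by blast
qed

lemma x_commute_power:
  assumes "i < n" "j < n"
  shows "\<exists>u\<in>units. x i * x j ^ k = u * x j ^ k * x i"
proof (induction k)
  case 0
  then show ?case using one_units by force
next
  case (Suc k)
  then obtain u where u: "u \<in> units" "x i * x j ^ k = u * x j ^ k * x i" by blast
  obtain c where c: "c \<in> units" "x i * x j = c * x j * x i" using x_commute[OF assms(2,1)] by blast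
  have "x i * x j ^ Suc k = (x i * x j) * x j ^ k" by (simp add: mult.assoc)
  also have "\<dots> = c * x j * (x i * x j ^ k)" by (simp add: c(2) mult.assoc)
  also have "\<dots> = c * (x j * u) * x j ^ k * x i" by (simp add: u(2) mult.assoc)
  also have "\<dots> = (c * sg j u) * x j ^ Suc k * x i"
    using x_mult_R[OF assms(2) units_in_R[OF u(1)]] by (simp add: mult.assoc)
  finally show ?case using units_mult[OF c(1) sigma_units[OF assms(2) u(1)]] by blast
qed

lemma R_mult_power_units:
  assumes "j < n" "u \<in> units"
  shows "\<exists>v\<in>units. x j ^ k * u = v * x j ^ k"
proof (induction k)
  case 0
  then show ?case using assms by simp
next
  case (Suc k)
  then obtain v where v: "v \<in> units" "x j ^ k * u = v * x j ^ k" by blast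
  have "x j ^ Suc k * u = x j * v * x j ^ k" using v by (simp add: mult.assoc)
  also have "\<dots> = sg j v * x j ^ Suc k" using x_mult_R[OF assms(1) units_in_R[OF v(1)]] by (simp add: mult.assoc)
  finally show ?case using sigma_units[OF assms(1) v(1)] by blast
qed

lemma x_commute_prod_list:
  assumes "i < n" "set L \<subseteq> {..<n}"
  shows "\<exists>u\<in>units. x i * prod_list (map (\<lambda>j. x j ^ \<alpha> j) L) = u * prod_list (map (\<lambda>j. x j ^ \<alpha> j) L) * x i"
  using assms(2)
proof (induction L)
  case Nil
  then show ?case using one_units by force
next
  case (Cons j L)
  define p where "p = prod_list (map (\<lambda>j. x j ^ \<alpha> j) L)"
  obtain u where u: "u \<in> units" "x i * p = u * p * x i" using Cons by (auto simp: p_def)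
  have j: "j < n" using Cons.prems by simp
  obtain v where v: "v \<in> units" "x i * x j ^ \<alpha> j = v * x j ^ \<alpha> j * x i" using x_commute_power[OF assms(1) j] by blast
  obtain w where w: "w \<in> units" "x j ^ \<alpha> j * u = w * x j ^ \<alpha> j" using R_mult_power_units[OF j u(1)] by blast
  have "x i * (x j ^ \<alpha> j * p) = v * x j ^ \<alpha> j * (x i * p)" using v by (simp add: mult.assoc[symmetric])
  also have "\<dots> = v * (x j ^ \<alpha> j * u) * p * x i" by (simp add: u(2) mult.assoc)
  also have "\<dots> = (v * w) * (x j ^ \<alpha> j * p) * x i" by (simp add: w(2) mult.assoc)
  finally show ?case using units_mult[OF v(1) w(1)] by (auto simp: p_def)
qed

lemma x_mult_xmon:
  assumes "i < n"
  shows "\<exists>u\<in>units. x i * mon \<alpha> = u * mon (eadd (unit_exp i) \<alpha>)"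
proof -
  let ?p = "prod_list (map (\<lambda>j. x j ^ \<alpha> j) [0..<i])"
  let ?q = "prod_list (map (\<lambda>j. x j ^ \<alpha> j) [Suc i..<n])"
  obtain u where u: "u \<in> units" "x i * ?p = u * ?p * x i"
    using x_commute_prod_list[OF assms, of "[0..<i]" \<alpha>] assms by (auto simp: subset_eq)
  have m: "map (\<lambda>k. x k ^ eadd (unit_exp i) \<alpha> k) [0..<i] = map (\<lambda>k. x k ^ \<alpha> k) [0..<i]"
    "map (\<lambda>k. x k ^ eadd (unit_exp i) \<alpha> k) [Suc i..<n] = map (\<lambda>k. x k ^ \<alpha> k) [Suc i..<n]"
    by (auto simp: eadd_def unit_exp_def)
  have "mon (eadd (unit_exp i) \<alpha>) = ?p * (x i ^ eadd (unit_exp i) \<alpha> i * ?q)"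
    unfolding xmon_def upt_split[OF assms] map_append list.map m by simp
  also have "x i ^ eadd (unit_exp i) \<alpha> i = x i * x i ^ \<alpha> i" by (simp add: eadd_def unit_exp_def)
  finally have e: "mon (eadd (unit_exp i) \<alpha>) = ?p * (x i * x i ^ \<alpha> i * ?q)" .
  have "x i * mon \<alpha> = x i * ?p * (x i ^ \<alpha> i * ?q)"
    unfolding xmon_def upt_split[OF assms] by (simp add: mult.assoc)
  also have "\<dots> = u * mon (eadd (unit_exp i) \<alpha>)" unfolding u(2) e by (simp add: mult.assoc)
  finally show ?thesis using u(1) by blast
qed

lemma x_power_mult_xmon:
  assumes "i < n"
  shows "\<exists>u\<in>units. x i ^ k * mon \<alpha> = u * mon (eadd (\<lambda>j. if j = i then k else 0) \<alpha>)"
proof (induction k)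
  case 0
  then show ?case using one_units by (auto simp: eadd_def intro: bexI[of _ 1])
next
  case (Suc k)
  let ?\<beta> = "eadd (\<lambda>j. if j = i then k else 0) \<alpha>"
  obtain u where u: "u \<in> units" "x i ^ k * mon \<alpha> = u * mon ?\<beta>" using Suc by blast
  obtain v where v: "v \<in> units" "x i * mon ?\<beta> = v * mon (eadd (unit_exp i) ?\<beta>)"
    using x_mult_xmon[OF assms] by blast
  have e: "eadd (unit_exp i) ?\<beta> = eadd (\<lambda>j. if j = i then Suc k else 0) \<alpha>"
    by (auto simp: eadd_def unit_exp_def)
  have "x i ^ Suc k * mon \<alpha> = x i * u * mon ?\<beta>" using u(2) by (simp add: mult.assoc)
  also have "\<dots> = sg i u * (x i * mon ?\<beta>)" using x_mult_R[OF assms units_in_R[OF u(1)]] by (simp add: mult.assoc)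
  also have "\<dots> = sg i u * v * mon (eadd (\<lambda>j. if j = i then Suc k else 0) \<alpha>)" unfolding v(2) e by (simp add: mult.assoc)
  finally show ?case using units_mult[OF sigma_units[OF assms u(1)] v(1)] by blast
qed

lemma prod_list_mult_xmon:
  assumes "set L \<subseteq> {..<n}" "distinct L"
  shows "\<exists>u\<in>units. prod_list (map (\<lambda>j. x j ^ \<alpha> j) L) * mon \<beta> =
    u * mon (eadd (\<lambda>j. if j \<in> set L then \<alpha> j else 0) \<beta>)"
  using assms
proof (induction L)
  case Nil
  then show ?case using one_units by (auto simp: eadd_def intro: bexI[of _ 1])
next
  case (Cons i L)
  let ?\<gamma> = "eadd (\<lambda>j. if j \<in> set L then \<alpha> j else 0) \<beta>"
  define p where "p = prod_list (map (\<lambda>j. x j ^ \<alpha> j) L)"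
  obtain u where u: "u \<in> units" "p * mon \<beta> = u * mon ?\<gamma>" using Cons by (auto simp: p_def)
  have i: "i < n" using Cons.prems by simp
  obtain v where v: "v \<in> units" "x i ^ \<alpha> i * u = v * x i ^ \<alpha> i" using R_mult_power_units[OF i u(1)] by blast
  obtain w where w: "w \<in> units" "x i ^ \<alpha> i * mon ?\<gamma> = w * mon (eadd (\<lambda>j. if j = i then \<alpha> i else 0) ?\<gamma>)"
    using x_power_mult_xmon[OF i] by blast
  have e: "eadd (\<lambda>j. if j = i then \<alpha> i else 0) ?\<gamma> = eadd (\<lambda>j. if j \<in> set (i # L) then \<alpha> j else 0) \<beta>"
    using Cons.prems by (auto simp: eadd_def)
  have "x i ^ \<alpha> i * p * mon \<beta> = x i ^ \<alpha> i * u * mon ?\<gamma>" using u(2) by (simp add: mult.assoc)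
  also have "\<dots> = v * (x i ^ \<alpha> i * mon ?\<gamma>)" by (simp add: v(2) mult.assoc)
  also have "\<dots> = v * w * mon (eadd (\<lambda>j. if j \<in> set (i # L) then \<alpha> j else 0) \<beta>)" unfolding w(2) e by (simp add: mult.assoc)
  finally show ?case using units_mult[OF v(1) w(1)] by (auto simp: p_def)
qed

lemma c_ab_units: "\<alpha> \<in> exps n \<Longrightarrow> \<beta> \<in> exps n \<Longrightarrow> cc \<alpha> \<beta> \<in> units"
  and xmon_mult: "\<alpha> \<in> exps n \<Longrightarrow> \<beta> \<in> exps n \<Longrightarrow> mon \<alpha> * mon \<beta> = cc \<alpha> \<beta> * mon (eadd \<alpha> \<beta>)"
proof -
  assume a: "\<alpha> \<in> exps n" "\<beta> \<in> exps n"
  obtain u where u: "u \<in> units"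
    "mon \<alpha> * mon \<beta> = u * mon (eadd (\<lambda>j. if j \<in> set [0..<n] then \<alpha> j else 0) \<beta>)"
    using prod_list_mult_xmon[of "[0..<n]" \<alpha> \<beta>] unfolding xmon_def[of x n \<alpha>] by (auto simp: subset_eq)
  have "(\<lambda>j. if j \<in> set [0..<n] then \<alpha> j else 0) = \<alpha>" using a by (auto simp: exps_def)
  with u have e: "mon \<alpha> * mon \<beta> = u * mon (eadd \<alpha> \<beta>)" by metis
  have "cc \<alpha> \<beta> = u"
    unfolding c_ab_def e using coef_monomial[OF units_in_R[OF u(1)] eadd_exps[OF a]] by simp
  with u e show "cc \<alpha> \<beta> \<in> units" "mon \<alpha> * mon \<beta> = cc \<alpha> \<beta> * mon (eadd \<alpha> \<beta>)" by auto
qed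

lemma coef_term_mult:
  assumes r: "r \<in> R" and \<alpha>: "\<alpha> \<in> exps n"
  shows "cf (r * mon \<alpha> * a) \<gamma> =
    (\<Sum>\<beta> | cf a \<beta> \<noteq> 0. if \<gamma> = eadd \<alpha> \<beta> then r * sgx \<alpha> (cf a \<beta>) * cc \<alpha> \<beta> else 0)"
proof -
  have "r * mon \<alpha> * a = (\<Sum>\<beta> | cf a \<beta> \<noteq> 0. r * mon \<alpha> * (cf a \<beta> * mon \<beta>))"
    unfolding sum_distrib_left[symmetric] by (rule arg_cong[OF coef_expansion])
  also have "\<dots> = (\<Sum>\<beta> | cf a \<beta> \<noteq> 0. r * sgx \<alpha> (cf a \<beta>) * cc \<alpha> \<beta> * mon (eadd \<alpha> \<beta>))"
  proof (rule sum.cong)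
    fix \<beta> assume "\<beta> \<in> {\<beta>. cf a \<beta> \<noteq> 0}"
    then have b: "\<beta> \<in> exps n" using coef_nonzero_exps by auto
    have "r * mon \<alpha> * (cf a \<beta> * mon \<beta>) = r * (mon \<alpha> * cf a \<beta>) * mon \<beta>" by (simp add: mult.assoc)
    also have "\<dots> = r * sgx \<alpha> (cf a \<beta>) * (mon \<alpha> * mon \<beta>)" by (simp add: xmon_mult_R mult.assoc)
    also have "\<dots> = r * sgx \<alpha> (cf a \<beta>) * cc \<alpha> \<beta> * mon (eadd \<alpha> \<beta>)" by (simp add: xmon_mult \<alpha> b mult.assoc)
    finally show "r * mon \<alpha> * (cf a \<beta> * mon \<beta>) = r * sgx \<alpha> (cf a \<beta>) * cc \<alpha> \<beta> * mon (eadd \<alpha> \<beta>)" .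
  qed simp
  finally have e: "r * mon \<alpha> * a = (\<Sum>\<beta> | cf a \<beta> \<noteq> 0. r * sgx \<alpha> (cf a \<beta>) * cc \<alpha> \<beta> * mon (eadd \<alpha> \<beta>))" .
  show ?thesis
    unfolding e coef_sum
  proof (rule sum.cong)
    fix \<beta> assume "\<beta> \<in> {\<beta>. cf a \<beta> \<noteq> 0}"
    then have b: "\<beta> \<in> exps n" using coef_nonzero_exps by auto
    show "cf (r * sgx \<alpha> (cf a \<beta>) * cc \<alpha> \<beta> * mon (eadd \<alpha> \<beta>)) \<gamma> =
        (if \<gamma> = eadd \<alpha> \<beta> then r * sgx \<alpha> (cf a \<beta>) * cc \<alpha> \<beta> else 0)"
      by (rule coef_monomial) (use r \<alpha> b in \<open>auto simp: R_closed eadd_exps units_in_R c_ab_units\<close>)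
  qed simp
qed

lemma coef_term_mult_eadd:
  assumes r: "r \<in> R" and \<alpha>: "\<alpha> \<in> exps n"
  shows "cf (r * mon \<alpha> * a) (eadd \<alpha> \<beta>) = r * sgx \<alpha> (cf a \<beta>) * cc \<alpha> \<beta>"
  unfolding coef_term_mult[OF assms] eadd_cancel
  using sigma_exp_zero[OF \<alpha>] by simp

lemma coef_term_mult_nonzero:
  assumes "r \<in> R" "\<alpha> \<in> exps n" "cf (r * mon \<alpha> * a) \<gamma> \<noteq> 0"
  shows "\<exists>\<beta>. \<gamma> = eadd \<alpha> \<beta> \<and> cf a \<beta> \<noteq> 0"
proof (rule ccontr)
  assume c: "\<not> ?thesis"
  have "cf (r * mon \<alpha> * a) \<gamma> = 0"
    unfolding coef_term_mult[OF assms(1,2)] by (rule sum.neutral) (use c in auto)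
  with assms(3) show False by simp
qed

end

subsection \<open>Leading monomials of vectors\<close>

locale qc_bij_PBW_order = qc_bij_PBW +
  fixes m :: nat
    and leA :: "(nat \<Rightarrow> nat) \<Rightarrow> (nat \<Rightarrow> nat) \<Rightarrow> bool"
    and leM :: "(nat \<Rightarrow> nat) \<times> nat \<Rightarrow> (nat \<Rightarrow> nat) \<times> nat \<Rightarrow> bool"
  assumes ordA: "monomial_order_A R x n leA"
    and ordM: "monomial_order_m R x n leA m leM"
begin

abbreviation "Mon \<equiv> exps n \<times> {1..m}"
abbreviation "lm \<equiv> lmv R x n m leM"
abbreviation "lc \<equiv> lcv R x n m leM"
abbreviation "supp \<equiv> suppv R x n m"

definition shift :: "(nat \<Rightarrow> nat) \<Rightarrow> (nat \<Rightarrow> nat) \<times> nat \<Rightarrow> (nat \<Rightarrow> nat) \<times> nat" where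
  "shift \<alpha> X = (eadd \<alpha> (fst X), snd X)"

definition cv :: "(nat \<Rightarrow> 'a) \<Rightarrow> (nat \<Rightarrow> nat) \<times> nat \<Rightarrow> 'a" where
  "cv f X = cf (f (snd X)) (fst X)"

lemma units_mult_eq_zero:
  assumes "u \<in> units" "a * u = 0"
  shows "a = 0"
proof -
  obtain v where "u * v = 1" using units_inverse assms by metis
  then show ?thesis using assms(2) by (metis mult.assoc mult.right_neutral mult_zero_left)
qed

lemma lmA_xmon_mult:
  assumes "\<gamma> \<in> exps n" "\<alpha> \<in> exps n"
  shows "lmA R x n leA (mon \<gamma> * mon \<alpha>) = eadd \<gamma> \<alpha>"
proof -
  have u: "cc \<gamma> \<alpha> \<in> units" using assms c_ab_units by blast
  then have "cc \<gamma> \<alpha> \<noteq> 0" using units_mult_eq_zero[of "cc \<gamma> \<alpha>" 1] by auto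
  then have c: "cf (mon \<gamma> * mon \<alpha>) \<beta> \<noteq> 0 \<longleftrightarrow> \<beta> = eadd \<gamma> \<alpha>" for \<beta>
    using xmon_mult[OF assms] coef_monomial[OF units_in_R[OF u] eadd_exps[OF assms]] by simp
  have "leA (eadd \<gamma> \<alpha>) (eadd \<gamma> \<alpha>)"
    using ordA eadd_exps[OF assms] unfolding monomial_order_A_def by blast
  then show ?thesis unfolding lmA_def c by auto
qed

lemma ordM_conjuncts:
  shows "\<forall>X\<in>Mon. leM X X"
    and "\<forall>X\<in>Mon. \<forall>Y\<in>Mon. leM X Y \<and> leM Y X \<longrightarrow> X = Y"
    and "\<forall>X\<in>Mon. \<forall>Y\<in>Mon. \<forall>Z\<in>Mon. leM X Y \<and> leM Y Z \<longrightarrow> leM X Z"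
    and "\<forall>X\<in>Mon. \<forall>Y\<in>Mon. leM X Y \<or> leM Y X"
    and "\<forall>\<alpha>\<in>exps n. \<forall>\<beta>\<in>exps n. \<forall>\<gamma>\<in>exps n. \<forall>i\<in>{1..m}. \<forall>j\<in>{1..m}.
        leM (\<alpha>, i) (\<beta>, j) \<longrightarrow>
        leM (lmA R x n leA (mon \<gamma> * mon \<alpha>), i) (lmA R x n leA (mon \<gamma> * mon \<beta>), j)"
    and "\<forall>X\<in>Mon. \<forall>Y\<in>Mon. deg n (fst X) < deg n (fst Y) \<longrightarrow> leM X Y \<and> X \<noteq> Y"
  by (insert ordM[unfolded monomial_order_m_def Let_def], elim conjE, assumption)+

lemma leM_refl: "X \<in> Mon \<Longrightarrow> leM X X"
  using ordM_conjuncts(1) by blast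

lemma leM_antisym: "X \<in> Mon \<Longrightarrow> Y \<in> Mon \<Longrightarrow> leM X Y \<Longrightarrow> leM Y X \<Longrightarrow> X = Y"
  using ordM_conjuncts(2) by blast

lemma leM_trans: "X \<in> Mon \<Longrightarrow> Y \<in> Mon \<Longrightarrow> Z \<in> Mon \<Longrightarrow> leM X Y \<Longrightarrow> leM Y Z \<Longrightarrow> leM X Z"
  using ordM_conjuncts(3) by blast

lemma leM_total: "X \<in> Mon \<Longrightarrow> Y \<in> Mon \<Longrightarrow> leM X Y \<or> leM Y X"
  using ordM_conjuncts(4) by blast

lemma leM_deg: "X \<in> Mon \<Longrightarrow> Y \<in> Mon \<Longrightarrow> deg n (fst X) < deg n (fst Y) \<Longrightarrow> leM X Y \<and> X \<noteq> Y"
  using ordM_conjuncts(6) by blast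

lemma shift_Mon: "\<alpha> \<in> exps n \<Longrightarrow> X \<in> Mon \<Longrightarrow> shift \<alpha> X \<in> Mon"
  by (auto simp: shift_def eadd_exps)

lemma shift_inj: "shift \<alpha> X = shift \<alpha> Y \<longleftrightarrow> X = Y"
  by (cases X; cases Y) (simp add: shift_def eadd_cancel)

lemma shift_mono:
  assumes "\<alpha> \<in> exps n" "X \<in> Mon" "Y \<in> Mon" "leM X Y"
  shows "leM (shift \<alpha> X) (shift \<alpha> Y)"
proof -
  obtain \<beta> i \<gamma> j where e: "X = (\<beta>, i)" "Y = (\<gamma>, j)" by (cases X; cases Y)
  then have b: "\<beta> \<in> exps n" "\<gamma> \<in> exps n" "i \<in> {1..m}" "j \<in> {1..m}" using assms by auto
  have "leM (lmA R x n leA (mon \<alpha> * mon \<beta>), i) (lmA R x n leA (mon \<alpha> * mon \<gamma>), j)"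
    using ordM_conjuncts(5)[rule_format, OF b(1,2) assms(1) b(3,4)] assms(4) e by simp
  then show ?thesis using b assms(1) by (simp add: lmA_xmon_mult shift_def e)
qed

lemma shift_shift: "shift \<alpha> (shift \<beta> X) = shift (eadd \<alpha> \<beta>) X"
  by (auto simp: shift_def eadd_def fun_eq_iff)

definition below :: "(nat \<Rightarrow> nat) \<times> nat \<Rightarrow> ((nat \<Rightarrow> nat) \<times> nat) set" where
  "below X = {Y \<in> Mon. leM Y X}"

definition sbelow :: "(nat \<Rightarrow> nat) \<times> nat \<Rightarrow> ((nat \<Rightarrow> nat) \<times> nat) set" where
  "sbelow X = {Y \<in> Mon. leM Y X \<and> Y \<noteq> X}"

definition downset :: "((nat \<Rightarrow> nat) \<times> nat) set \<Rightarrow> bool" where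
  "downset P \<longleftrightarrow> (\<forall>Y\<in>P. \<forall>Z\<in>Mon. leM Z Y \<longrightarrow> Z \<in> P)"

lemma downset_below:
  assumes "X \<in> Mon"
  shows "downset (below X)"
  unfolding downset_def
proof (intro ballI impI)
  fix Y Z assume "Y \<in> below X" "Z \<in> Mon" "leM Z Y"
  then show "Z \<in> below X" using leM_trans[of Z Y X] assms unfolding below_def by simp
qed

lemma downset_sbelow:
  assumes "X \<in> Mon"
  shows "downset (sbelow X)"
  unfolding downset_def
proof (intro ballI impI)
  fix Y Z assume a: "Y \<in> sbelow X" "Z \<in> Mon" "leM Z Y"
  then have Y: "Y \<in> Mon" "leM Y X" "Y \<noteq> X" by (simp_all add: sbelow_def)
  have "Z \<noteq> X" using leM_antisym[OF Y(1) assms Y(2)] a(3) Y(3) by auto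
  then show "Z \<in> sbelow X" using leM_trans[OF a(2) Y(1) assms a(3) Y(2)] a(2) by (simp add: sbelow_def)
qed

lemma below_eq: "X \<in> Mon \<Longrightarrow> below X = insert X (sbelow X)"
  unfolding below_def sbelow_def using leM_refl by blast

lemma finite_below:
  assumes "X \<in> Mon"
  shows "finite (below X)"
proof (rule finite_subset)
  show "below X \<subseteq> {\<alpha> \<in> exps n. deg n \<alpha> \<le> deg n (fst X)} \<times> {1..m}"
  proof
    fix Y assume "Y \<in> below X"
    then have Y: "Y \<in> Mon" "leM Y X" by (auto simp: below_def)
    have "\<not> deg n (fst X) < deg n (fst Y)"
      using leM_deg[OF assms Y(1)] leM_antisym[OF assms Y(1)] Y(2) by blast
    then show "Y \<in> {\<alpha> \<in> exps n. deg n \<alpha> \<le> deg n (fst X)} \<times> {1..m}" using Y(1) by auto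
  qed
qed (simp add: finite_exps_deg)

lemma Mon_induct [consumes 1, case_names less]:
  assumes "X \<in> Mon"
    and step: "\<And>X. X \<in> Mon \<Longrightarrow> (\<And>Y. Y \<in> sbelow X \<Longrightarrow> P Y) \<Longrightarrow> P X"
  shows "P X"
  using assms(1)
proof (induction "card (sbelow X)" arbitrary: X rule: less_induct)
  case less
  show ?case
  proof (rule step[OF less.prems])
    fix Y assume Y: "Y \<in> sbelow X"
    then have YM: "Y \<in> Mon" by (auto simp: sbelow_def)
    have "sbelow Y \<subset> sbelow X"
    proof
      show "sbelow Y \<subseteq> sbelow X"
        using downset_sbelow[OF less.prems] Y unfolding downset_def by (auto simp: sbelow_def[of Y])
      show "sbelow Y \<noteq> sbelow X" using Y by (auto simp: sbelow_def[of Y])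
    qed
    moreover have "finite (sbelow X)"
      using finite_below[OF less.prems] below_eq[OF less.prems] by simp
    ultimately have "card (sbelow Y) < card (sbelow X)" by (rule psubset_card_mono[rotated])
    then show "P Y" using less.hyps YM by blast
  qed
qed

lemma supp_iff: "X \<in> supp f \<longleftrightarrow> snd X \<in> {1..m} \<and> cv f X \<noteq> 0"
  by (cases X) (simp add: suppv_def cv_def)

lemma supp_Mon: "supp f \<subseteq> Mon"
  using coef_nonzero_exps by (fastforce simp: supp_iff cv_def)

lemma finite_supp: "finite (supp f)"
proof (rule finite_subset)
  show "supp f \<subseteq> (\<Union>i\<in>{1..m}. {\<alpha>. cf (f i) \<alpha> \<noteq> 0} \<times> {i})"
    by (auto simp: supp_iff cv_def)
qed auto

lemma supp_empty:
  assumes "f \<in> vecs m" "supp f = {}"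
  shows "f = zvec"
proof
  fix k
  show "f k = zvec k"
  proof (cases "k \<in> {1..m}")
    case True
    then have "cf (f k) \<alpha> = 0" for \<alpha>
      using assms(2) supp_iff[of "(\<alpha>, k)" f] by (auto simp: cv_def)
    then have "f k = (\<Sum>\<alpha>\<in>{}. cf (f k) \<alpha> * mon \<alpha>)" by (intro coef_expansion_superset) auto
    then show ?thesis by (simp add: zvec_def)
  next
    case False
    then show ?thesis using assms(1) by (simp add: vecs_def zvec_def)
  qed
qed

lemma finite_has_max:
  assumes "finite S" "S \<noteq> {}" "S \<subseteq> Mon"
  shows "\<exists>X\<in>S. \<forall>Y\<in>S. leM Y X"
  using assms
proof (induction S rule: finite_ne_induct)
  case (singleton X)
  then show ?case using leM_refl by blast
next
  case (insert Z S)
  then obtain X where X: "X \<in> S" "\<forall>Y\<in>S. leM Y X" by blast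
  have M: "X \<in> Mon" "Z \<in> Mon" using X insert.prems by auto
  consider "leM X Z" | "leM Z X" using leM_total M by blast
  then show ?case
  proof cases
    case 1
    have "leM Y Z" if "Y \<in> insert Z S" for Y
    proof (cases "Y = Z")
      case False
      then have Y: "Y \<in> Mon" "leM Y X" using that insert.prems X(2) by auto
      from leM_trans[OF Y(1) M Y(2) 1] show ?thesis .
    qed (use leM_refl[OF M(2)] in simp)
    then show ?thesis by blast
  next
    case 2
    then show ?thesis using X by blast
  qed
qed

lemma lm_eqI:
  assumes "X \<in> supp f" "\<And>Y. Y \<in> supp f \<Longrightarrow> leM Y X"
  shows "lm f = X"
  unfolding lmv_def
proof (rule the_equality)
  fix Z assume "Z \<in> supp f \<and> (\<forall>Y\<in>supp f. leM Y Z)"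
  then show "Z = X" using assms leM_antisym[of Z X] supp_Mon[of f] by auto
qed (use assms in blast)

lemma lm_supp: "f \<in> vecs m \<Longrightarrow> f \<noteq> zvec \<Longrightarrow> lm f \<in> supp f"
  and lm_max: "f \<in> vecs m \<Longrightarrow> f \<noteq> zvec \<Longrightarrow> Y \<in> supp f \<Longrightarrow> leM Y (lm f)"
proof -
  assume a: "f \<in> vecs m" "f \<noteq> zvec"
  then obtain X where X: "X \<in> supp f" "\<forall>Y\<in>supp f. leM Y X"
    using finite_has_max[OF finite_supp _ supp_Mon] supp_empty by blast
  then have "lm f = X" using lm_eqI by blast
  with X show "lm f \<in> supp f" "Y \<in> supp f \<Longrightarrow> leM Y (lm f)" by auto
qed

lemma lm_Mon: "f \<in> vecs m \<Longrightarrow> f \<noteq> zvec \<Longrightarrow> lm f \<in> Mon"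
  using lm_supp supp_Mon by blast

lemma supp_subset_below_lm: "f \<in> vecs m \<Longrightarrow> f \<noteq> zvec \<Longrightarrow> supp f \<subseteq> below (lm f)"
  unfolding below_def using lm_max supp_Mon by blast

lemma lc_eq: "lc f = cv f (lm f)"
  by (simp add: lcv_def cv_def)

lemma cv_in_R [simp]: "cv f X \<in> R"
  by (simp add: cv_def)

lemma cv_zero [simp]: "cv (\<lambda>_. 0) X = 0" "cv zvec X = 0"
  by (simp_all add: cv_def zvec_def)

lemma cv_add: "cv (\<lambda>k. f k + g k) X = cv f X + cv g X"
  by (simp add: cv_def coef_add)

lemma cv_diff: "cv (\<lambda>k. f k - g k) X = cv f X - cv g X"
  by (simp add: cv_def coef_diff)

lemma cv_sum: "cv (\<lambda>k. \<Sum>i\<in>S. f i k) X = (\<Sum>i\<in>S. cv (f i) X)"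
  by (simp add: cv_def coef_sum)

lemma cv_term:
  assumes "r \<in> R" "\<alpha> \<in> exps n"
  shows "cv (\<lambda>k. r * mon \<alpha> * g k) (shift \<alpha> X) = r * sgx \<alpha> (cv g X) * cc \<alpha> (fst X)"
  using coef_term_mult_eadd[OF assms] by (simp add: cv_def shift_def)

lemma supp_term:
  assumes "r \<in> R" "\<alpha> \<in> exps n"
  shows "supp (\<lambda>k. r * mon \<alpha> * g k) \<subseteq> shift \<alpha> ` supp g"
proof
  fix Z assume Z: "Z \<in> supp (\<lambda>k. r * mon \<alpha> * g k)"
  then have "cf (r * mon \<alpha> * g (snd Z)) (fst Z) \<noteq> 0" by (simp add: supp_iff cv_def)
  from coef_term_mult_nonzero[OF assms this] obtain \<beta> where
    b: "fst Z = eadd \<alpha> \<beta>" "cf (g (snd Z)) \<beta> \<noteq> 0" by blast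
  then have "(\<beta>, snd Z) \<in> supp g" using Z by (simp add: supp_iff cv_def)
  moreover have "Z = shift \<alpha> (\<beta>, snd Z)" using b(1) by (cases Z) (simp add: shift_def)
  ultimately show "Z \<in> shift \<alpha> ` supp g" by blast
qed

lemma supp_term_lm:
  assumes "r \<in> R" "\<alpha> \<in> exps n" "g \<in> vecs m" "g \<noteq> zvec"
  shows "supp (\<lambda>k. r * mon \<alpha> * g k) \<subseteq> below (shift \<alpha> (lm g))"
proof
  fix Z assume "Z \<in> supp (\<lambda>k. r * mon \<alpha> * g k)"
  then obtain Y where Y: "Y \<in> supp g" "Z = shift \<alpha> Y" using supp_term[OF assms(1,2)] by blast
  then have "Y \<in> Mon" using supp_Mon by blast
  then show "Z \<in> below (shift \<alpha> (lm g))"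
    using Y shift_mono[OF assms(2) _ lm_Mon[OF assms(3,4)] lm_max[OF assms(3,4)]]
      shift_Mon[OF assms(2)] by (auto simp: below_def)
qed

lemma supp_add: "supp (\<lambda>k. f k + g k) \<subseteq> supp f \<union> supp g"
  by (auto simp: supp_iff cv_add)

lemma supp_diff: "supp (\<lambda>k. f k - g k) \<subseteq> supp f \<union> supp g"
  by (auto simp: supp_iff cv_diff)

lemma supp_sum: "supp (\<lambda>k. \<Sum>i\<in>S. f i k) \<subseteq> (\<Union>i\<in>S. supp (f i))"
  by (auto simp: supp_iff cv_sum) (metis sum.neutral)

lemma supp_zvec [simp]: "supp zvec = {}"
  by (auto simp: supp_iff)

end

subsection \<open>Combinations of the generators\<close>

locale qc_bij_PBW_generators = qc_bij_PBW_order +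
  fixes G :: "(nat \<Rightarrow> 'a) set"
  assumes G_vecs: "G \<subseteq> vecs m" and finite_G: "finite G" and zvec_notin_G: "zvec \<notin> G"
begin

lemma G_D: "g \<in> G \<Longrightarrow> g \<in> vecs m \<and> g \<noteq> zvec"
  using G_vecs zvec_notin_G by auto

lemma lm_G_Mon: "g \<in> G \<Longrightarrow> lm g \<in> Mon"
  using G_D lm_Mon by simp

inductive_set comb :: "((nat \<Rightarrow> nat) \<times> nat) set \<Rightarrow> (nat \<Rightarrow> 'a) set" for P where
  zero: "zvec \<in> comb P"
| step: "v \<in> comb P \<Longrightarrow> r \<in> R \<Longrightarrow> \<alpha> \<in> exps n \<Longrightarrow> g \<in> G \<Longrightarrow> shift \<alpha> (lm g) \<in> P \<Longrightarrow>
    (\<lambda>k. v k + r * mon \<alpha> * g k) \<in> comb P"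

lemma comb_vecs: "v \<in> comb P \<Longrightarrow> v \<in> vecs m"
proof (induction rule: comb.induct)
  case (step v r \<alpha> g)
  then show ?case using G_D[of g] by (simp add: vecs_def)
qed (simp add: vecs_def zvec_def)

lemma comb_supp:
  assumes "v \<in> comb P" "downset P"
  shows "supp v \<subseteq> P"
  using assms(1)
proof (induction rule: comb.induct)
  case (step v r \<alpha> g)
  have "supp (\<lambda>k. r * mon \<alpha> * g k) \<subseteq> below (shift \<alpha> (lm g))"
    using supp_term_lm step G_D by simp
  also have "\<dots> \<subseteq> P" using assms(2) step unfolding downset_def below_def by blast
  finally show ?case using supp_add[of v "\<lambda>k. r * mon \<alpha> * g k"] step.IH by blast
qed simp

lemma comb_mono:
  assumes "v \<in> comb P" "P \<subseteq> Q"
  shows "v \<in> comb Q"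
  using assms(1)
proof (induction rule: comb.induct)
  case (step v r \<alpha> g)
  then show ?case using assms(2) by (intro comb.step) auto
qed (rule comb.zero)

lemma comb_term:
  assumes "r \<in> R" "\<alpha> \<in> exps n" "g \<in> G" "shift \<alpha> (lm g) \<in> P"
  shows "(\<lambda>k. r * mon \<alpha> * g k) \<in> comb P"
  using comb.step[OF comb.zero assms] by (simp add: zvec_def)

lemma comb_add:
  assumes "v \<in> comb P" "w \<in> comb P"
  shows "(\<lambda>k. v k + w k) \<in> comb P"
  using assms(2)
proof (induction rule: comb.induct)
  case (step w r \<alpha> g)
  then show ?case using comb.step[of "\<lambda>k. v k + w k" P r \<alpha> g] by (simp add: add.assoc)
qed (simp add: assms(1) zvec_def)

lemma comb_sum:
  assumes "\<And>i. i \<in> S \<Longrightarrow> f i \<in> comb P"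
  shows "(\<lambda>k. \<Sum>i\<in>S. f i k) \<in> comb P"
  using assms
proof (induction S rule: infinite_finite_induct)
  case (insert i S)
  then show ?case using comb_add[of "f i" P "\<lambda>k. \<Sum>i\<in>S. f i k"] by simp
qed (use comb.zero[of P] in \<open>simp_all add: zvec_def\<close>)

lemma comb_term_mult:
  assumes "v \<in> comb P" "s \<in> R" "\<delta> \<in> exps n" "\<And>Y. Y \<in> P \<Longrightarrow> Y \<in> Mon \<Longrightarrow> shift \<delta> Y \<in> Q"
  shows "(\<lambda>k. s * mon \<delta> * v k) \<in> comb Q"
  using assms(1)
proof (induction rule: comb.induct)
  case zero
  then show ?case using comb.zero[of Q] by (simp add: zvec_def)
next
  case (step v r \<alpha> g)
  have "s * mon \<delta> * (r * mon \<alpha> * g k) = s * sgx \<delta> r * cc \<delta> \<alpha> * mon (eadd \<delta> \<alpha>) * g k" for k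
  proof -
    have "s * mon \<delta> * (r * mon \<alpha> * g k) = s * (mon \<delta> * r) * mon \<alpha> * g k" by (simp add: mult.assoc)
    also have "\<dots> = s * sgx \<delta> r * (mon \<delta> * mon \<alpha>) * g k"
      using xmon_mult_R[OF step.hyps(2)] by (simp add: mult.assoc)
    also have "\<dots> = s * sgx \<delta> r * cc \<delta> \<alpha> * mon (eadd \<delta> \<alpha>) * g k"
      using xmon_mult[OF assms(3) step.hyps(3)] by (simp add: mult.assoc)
    finally show ?thesis .
  qed
  moreover have "s * sgx \<delta> r * cc \<delta> \<alpha> \<in> R"
    using assms(2,3) step.hyps by (simp add: R_closed units_in_R c_ab_units)
  moreover have "shift (eadd \<delta> \<alpha>) (lm g) \<in> Q"
    using assms(4)[OF step.hyps(5)] shift_Mon[OF step.hyps(3) lm_G_Mon[OF step.hyps(4)]]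
    by (simp add: shift_shift)
  ultimately show ?case
    using comb.step[OF step.IH, of "s * sgx \<delta> r * cc \<delta> \<alpha>" "eadd \<delta> \<alpha>" g] step.hyps assms(3)
    by (simp add: eadd_exps distrib_left)
qed

lemma red_decomposition:
  assumes "red R x n m leM G f h" "f \<in> vecs m" "f \<noteq> zvec"
  shows "\<exists>w\<in>comb {lm f}. f = (\<lambda>k. h k + w k)" and "h \<in> vecs m" and "supp h \<subseteq> sbelow (lm f)"
proof -
  obtain t :: nat and fs rs als where
    fs: "\<And>i. i < t \<Longrightarrow> fs i \<in> G" and rs: "\<And>i. i < t \<Longrightarrow> rs i \<in> R" and
    snds: "\<And>i. i < t \<Longrightarrow> snd (lm (fs i)) = snd (lm f)" and
    fsts: "\<And>i k. i < t \<Longrightarrow> als i k + fst (lm (fs i)) k = fst (lm f) k" and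
    lc: "lc f = (\<Sum>i<t. rs i * sgx (als i) (lc (fs i)) * cc (als i) (fst (lm (fs i))))" and
    h: "h = (\<lambda>k. f k - (\<Sum>i<t. rs i * mon (als i) * fs i k))"
    using assms(1,3) unfolding red_def by blast
  have lmf: "lm f \<in> Mon" using lm_Mon assms by blast
  have als: "als i \<in> exps n" if "i < t" for i
  proof -
    have "als i k = 0" if "k \<ge> n" for k
      using fsts[OF \<open>i < t\<close>, of k] lmf that by (auto simp: exps_def mem_Times_iff)
    then show ?thesis by (simp add: exps_def)
  qed
  have sh: "shift (als i) (lm (fs i)) = lm f" if "i < t" for i
    using fsts[OF that] snds[OF that] by (auto simp: shift_def eadd_def prod_eq_iff)
  define w where "w = (\<lambda>k. \<Sum>i<t. rs i * mon (als i) * fs i k)"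
  have w: "w \<in> comb {lm f}"
    unfolding w_def by (rule comb_sum, rule comb_term) (auto simp: fs rs als sh)
  moreover have "f = (\<lambda>k. h k + w k)" by (simp add: h w_def)
  ultimately show "\<exists>w\<in>comb {lm f}. f = (\<lambda>k. h k + w k)" by blast
  have hw: "h = (\<lambda>k. f k - w k)" by (simp add: h w_def)
  show "h \<in> vecs m" using comb_vecs[OF w] assms(2) by (simp add: hw vecs_def)
  have "w \<in> comb (below (lm f))"
    by (rule comb_mono[OF w]) (use below_eq[OF lmf] in auto)
  then have "supp w \<subseteq> below (lm f)" using comb_supp downset_below[OF lmf] by blast
  then have sub: "supp h \<subseteq> below (lm f)"
    using supp_diff[of f w] supp_subset_below_lm[OF assms(2,3)] by (auto simp: hw)
  have "cv w (lm f) = (\<Sum>i<t. cv (\<lambda>k. rs i * mon (als i) * fs i k) (lm f))"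
    by (simp add: w_def cv_sum)
  also have "\<dots> = lc f"
    unfolding lc
  proof (rule sum.cong)
    fix i assume "i \<in> {..<t}"
    then have i: "i < t" by simp
    show "cv (\<lambda>k. rs i * mon (als i) * fs i k) (lm f) =
      rs i * sgx (als i) (lc (fs i)) * cc (als i) (fst (lm (fs i)))"
      using cv_term[OF rs[OF i] als[OF i], of "fs i" "lm (fs i)"] by (simp add: sh[OF i] lc_eq)
  qed simp
  finally have "cv h (lm f) = 0" by (simp add: hw cv_diff lc_eq)
  then have "lm f \<notin> supp h" by (simp add: supp_iff)
  then show "supp h \<subseteq> sbelow (lm f)" using sub unfolding below_eq[OF lmf] by blast
qed

lemma red_step_comb:
  assumes "red R x n m leM G f h" "f \<in> vecs m" "supp f \<subseteq> P" "downset P"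
    and "h \<in> vecs m \<Longrightarrow> supp h \<subseteq> P \<Longrightarrow> h \<in> comb P"
  shows "f \<in> comb P"
proof (cases "f = zvec")
  case True
  then show ?thesis by (simp add: comb.zero)
next
  case False
  have lm: "lm f \<in> P" using lm_supp[OF assms(2) False] assms(3) by blast
  obtain w where w: "w \<in> comb {lm f}" "f = (\<lambda>k. h k + w k)"
    using red_decomposition(1)[OF assms(1,2) False] by blast
  have "supp h \<subseteq> P"
    using red_decomposition(3)[OF assms(1,2) False] lm assms(4) unfolding downset_def sbelow_def by blast
  then have "h \<in> comb P" using assms(5) red_decomposition(2)[OF assms(1,2) False] by blast
  moreover have "w \<in> comb P" using comb_mono[OF w(1)] lm by blast
  ultimately have "(\<lambda>k. h k + w k) \<in> comb P" by (rule comb_add)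
  then show ?thesis using w(2) by simp
qed

lemma red_plus_comb:
  assumes "red_plus R x n m leM G f zvec" "f \<in> vecs m" "supp f \<subseteq> P" "downset P"
  shows "f \<in> comb P"
  using assms(1-3) unfolding red_plus_def
proof (induction rule: converse_tranclp_induct)
  case (base f)
  then show ?case using red_step_comb[OF _ _ _ assms(4)] comb.zero by blast
next
  case (step f h)
  then show ?case using red_step_comb[OF step.hyps(1) _ _ assms(4)] by blast
qed

lemma reducibleI:
  assumes "f \<noteq> zvec" "F \<subseteq> G" "\<And>g. g \<in> F \<Longrightarrow> r g \<in> R"
    and "\<And>g. g \<in> F \<Longrightarrow> shift (al g) (lm g) = lm f"
    and "lc f = (\<Sum>g\<in>F. r g * sgx (al g) (lc g) * cc (al g) (fst (lm g)))"
  shows "reducible R x n m leM G f"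
proof -
  have "finite F" using assms(2) finite_G finite_subset by blast
  then obtain e where e: "bij_betw e {0..<card F} F" using ex_bij_betw_nat_finite by blast
  then have e': "bij_betw e {..<card F} F" by (simp add: atLeast0LessThan)
  have eF: "e i \<in> F" if "i < card F" for i using e' that by (auto simp: bij_betw_def)
  have sn: "snd (lm g) = snd (lm f)" and fs: "al g k + fst (lm g) k = fst (lm f) k" if "g \<in> F" for g k
    using assms(4)[OF that] by (auto simp: shift_def eadd_def prod_eq_iff fun_eq_iff)
  have "lc f = (\<Sum>i<card F. r (e i) * sgx (al (e i)) (lc (e i)) * cc (al (e i)) (fst (lm (e i))))"
    unfolding assms(5) by (rule sum.reindex_bij_betw[OF e', symmetric])
  then have "red R x n m leM G f (\<lambda>k. f k - (\<Sum>i<card F. r (e i) * mon (al (e i)) * e i k))"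
    unfolding red_def using assms(1,2,3) eF sn fs
    by (intro disjI2 conjI exI[of _ "card F"] exI[of _ e] exI[of _ "\<lambda>i. r (e i)"] exI[of _ "\<lambda>i. al (e i)"])
      auto
  then show ?thesis using assms(1) unfolding reducible_def by blast
qed

lemma span_A_subset_sum:
  assumes "F \<subseteq> G"
  shows "(\<lambda>k. \<Sum>g\<in>F. a g * g k) \<in> span_A G"
proof -
  have "(\<Sum>g\<in>F. a g * g k) = (\<Sum>g\<in>G. (if g \<in> F then a g else 0) * g k)" for k
    by (rule sum.mono_neutral_cong_left) (use assms finite_G in auto)
  then show ?thesis unfolding span_A_def
    by (intro CollectI exI[of _ "\<lambda>g. if g \<in> F then a g else 0"]) simp
qed

lemma span_A_term: "g \<in> G \<Longrightarrow> (\<lambda>k. a * g k) \<in> span_A G"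
  using span_A_subset_sum[of "{g}" "\<lambda>_. a"] by simp

lemma comb_span_A: "v \<in> comb P \<Longrightarrow> v \<in> span_A G"
proof (induction rule: comb.induct)
  case zero
  then show ?case using span_A_subset_sum[of "{}"] by (simp add: zvec_def)
next
  case (step v r \<alpha> g)
  then show ?case using span_A_add[OF step.IH span_A_term] by simp
qed

lemma span_A_comb: "f \<in> span_A G \<Longrightarrow> f \<in> comb Mon"
proof -
  assume "f \<in> span_A G"
  then obtain a where f: "f = (\<lambda>k. \<Sum>g\<in>G. a g * g k)" by (auto simp: span_A_def)
  have e: "a g * g k = (\<Sum>\<alpha> | cf (a g) \<alpha> \<noteq> 0. cf (a g) \<alpha> * mon \<alpha> * g k)" for g k
    unfolding sum_distrib_right[symmetric] by (rule arg_cong[OF coef_expansion])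
  have "f = (\<lambda>k. \<Sum>g\<in>G. \<Sum>\<alpha> | cf (a g) \<alpha> \<noteq> 0. cf (a g) \<alpha> * mon \<alpha> * g k)"
    unfolding f by (intro ext sum.cong e refl)
  also have "\<dots> \<in> comb Mon"
  proof (intro comb_sum comb_term)
    fix g \<alpha> assume g: "g \<in> G" "\<alpha> \<in> {\<alpha>. cf (a g) \<alpha> \<noteq> 0}"
    then show \<alpha>: "\<alpha> \<in> exps n" using coef_nonzero_exps by simp
    show "shift \<alpha> (lm g) \<in> Mon" by (rule shift_Mon[OF \<alpha> lm_G_Mon[OF g(1)]])
  qed simp_all
  finally show ?thesis .
qed

lemma below_mono: "X \<in> Mon \<Longrightarrow> Y \<in> Mon \<Longrightarrow> leM X Y \<Longrightarrow> below X \<subseteq> below Y"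
  unfolding below_def using leM_trans[of _ X Y] by auto

lemma comb_below:
  assumes "v \<in> comb P"
  shows "v = zvec \<or> (\<exists>Y\<in>P \<inter> Mon. v \<in> comb (below Y))"
  using assms
proof (induction rule: comb.induct)
  case (step v r \<alpha> g)
  define Z where "Z = shift \<alpha> (lm g)"
  have Z: "Z \<in> Mon" "Z \<in> P" using step.hyps shift_Mon lm_G_Mon by (auto simp: Z_def simp del: mem_Sigma_iff)
  have st: "(\<lambda>k. v k + r * mon \<alpha> * g k) \<in> comb Q" if "v \<in> comb Q" "Z \<in> Q" for Q
    using comb.step that step.hyps by (simp add: Z_def)
  have ZZ: "Z \<in> below Z" using below_eq[OF Z(1)] by simp
  consider "v = zvec" | Y where "Y \<in> P" "Y \<in> Mon" "v \<in> comb (below Y)" using step.IH by blast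
  then show ?case
  proof cases
    case 1
    then have "v \<in> comb (below Z)" by (simp add: comb.zero)
    from st[OF this ZZ] show ?thesis using Z by blast
  next
    case (2 Y)
    consider "leM Y Z" | "leM Z Y" using leM_total[OF 2(2) Z(1)] by blast
    then show ?thesis
    proof cases
      case 1
      have "v \<in> comb (below Z)" by (rule comb_mono[OF 2(3) below_mono[OF 2(2) Z(1) 1]])
      from st[OF this ZZ] show ?thesis using Z by blast
    next
      case b: 2
      then have "Z \<in> below Y" using Z(1) by (simp add: below_def)
      from st[OF 2(3) this] show ?thesis using 2 by blast
    qed
  qed
qed simp

definition divisors :: "(nat \<Rightarrow> nat) \<times> nat \<Rightarrow> (nat \<Rightarrow> 'a) set" where
  "divisors X = {g \<in> G. snd (lm g) = snd X \<and> (\<forall>k. fst (lm g) k \<le> fst X k)}"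

definition quot :: "(nat \<Rightarrow> nat) \<times> nat \<Rightarrow> (nat \<Rightarrow> 'a) \<Rightarrow> nat \<Rightarrow> nat" where
  "quot X g = (\<lambda>k. fst X k - fst (lm g) k)"

lemma shift_quot: "g \<in> divisors X \<Longrightarrow> shift (quot X g) (lm g) = X"
  by (auto simp: divisors_def quot_def shift_def eadd_def prod_eq_iff fun_eq_iff)

lemma quot_exps: "X \<in> Mon \<Longrightarrow> quot X g \<in> exps n"
  by (auto simp: quot_def exps_def)

lemma shift_eq_quot:
  assumes "g \<in> G" "shift \<alpha> (lm g) = X"
  shows "g \<in> divisors X" "\<alpha> = quot X g"
  using assms by (auto simp: divisors_def quot_def shift_def eadd_def)

lemma finite_divisors: "finite (divisors X)"
  using finite_G by (simp add: divisors_def)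

lemma comb_split:
  assumes X: "X \<in> Mon" and f: "f \<in> comb (below X)"
  shows "\<exists>r w. (\<forall>g. r g \<in> R) \<and> w \<in> comb (sbelow X) \<and>
    f = (\<lambda>k. w k + (\<Sum>g\<in>divisors X. r g * mon (quot X g) * g k))"
  using f
proof (induction rule: comb.induct)
  case zero
  show ?case
    by (rule exI[of _ "\<lambda>_. 0"], rule exI[of _ zvec]) (use comb.zero[of "sbelow X"] in \<open>simp add: R_closed zvec_def\<close>)
next
  case (step v s \<alpha> h)
  obtain r w where r: "\<And>g. r g \<in> R" and w: "w \<in> comb (sbelow X)"
    and v: "v = (\<lambda>k. w k + (\<Sum>g\<in>divisors X. r g * mon (quot X g) * g k))"
    using step.IH by blast
  show ?case
  proof (cases "shift \<alpha> (lm h) = X")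
    case True
    note h = shift_eq_quot[OF step.hyps(4) True]
    let ?r = "r(h := r h + s)"
    have "(\<Sum>g\<in>divisors X. ?r g * mon (quot X g) * g k) =
        (\<Sum>g\<in>divisors X. r g * mon (quot X g) * g k) + s * mon \<alpha> * h k" for k
    proof -
      have "(\<Sum>g\<in>divisors X. ?r g * mon (quot X g) * g k) =
        (\<Sum>g\<in>divisors X. r g * mon (quot X g) * g k + (if g = h then s * mon \<alpha> * h k else 0))"
        by (rule sum.cong) (auto simp: h(2) distrib_right)
      also have "\<dots> = (\<Sum>g\<in>divisors X. r g * mon (quot X g) * g k) + s * mon \<alpha> * h k"
        using h(1) finite_divisors by (simp add: sum.distrib)
      finally show ?thesis .
    qed
    then have "(\<lambda>k. v k + s * mon \<alpha> * h k) = (\<lambda>k. w k + (\<Sum>g\<in>divisors X. ?r g * mon (quot X g) * g k))"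
      by (simp add: v add.assoc)
    moreover have "\<forall>g. ?r g \<in> R" using r step.hyps by (simp add: R_closed)
    ultimately show ?thesis using w by blast
  next
    case False
    then have "shift \<alpha> (lm h) \<in> sbelow X" using step.hyps(5) by (simp add: below_def sbelow_def)
    then have "(\<lambda>k. w k + s * mon \<alpha> * h k) \<in> comb (sbelow X)"
      using comb.step[OF w] step.hyps by blast
    moreover have "(\<lambda>k. v k + s * mon \<alpha> * h k) =
      (\<lambda>k. w k + s * mon \<alpha> * h k + (\<Sum>g\<in>divisors X. r g * mon (quot X g) * g k))"
      by (simp add: v algebra_simps)
    ultimately show ?thesis using r by blast
  qed
qed

subsection \<open>Syzygies of leading coefficients\<close>

abbreviation "\<gamma>F \<equiv> gammaF R x n m leM"

definition spoly :: "(nat \<Rightarrow> 'a) set \<Rightarrow> ((nat \<Rightarrow> 'a) \<Rightarrow> 'a) \<Rightarrow> nat \<Rightarrow> 'a" where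
  "spoly F b = (\<lambda>k. \<Sum>g\<in>F. b g * mon (\<gamma>F F g) * g k)"

lemma exp_XF_facts:
  assumes X: "X \<in> Mon" and F: "F \<subseteq> divisors X" "F \<noteq> {}"
  defines "E \<equiv> exp_XF R x n m leM F"
  shows "E \<in> exps n" "E k \<le> fst X k"
    and "g \<in> F \<Longrightarrow> fst (lm g) k \<le> E k" "g \<in> F \<Longrightarrow> \<gamma>F F g \<in> exps n"
    and "g \<in> F \<Longrightarrow> shift (\<gamma>F F g) (lm g) = (E, snd X)"
proof -
  have fin: "finite F" using F(1) finite_divisors finite_subset by blast
  show le: "E k \<le> fst X k" for k
    unfolding E_def exp_XF_def using fin F by (auto simp: divisors_def)
  show ge: "fst (lm g) k \<le> E k" if "g \<in> F" for g k
    unfolding E_def exp_XF_def using fin that by (intro Max_ge) auto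
  show E: "E \<in> exps n"
    unfolding exps_def
  proof (intro CollectI allI impI)
    fix k assume "n \<le> k"
    then have "fst X k = 0" using X by (auto simp: exps_def)
    then show "E k = 0" using le[of k] by simp
  qed
  show "\<gamma>F F g \<in> exps n" if "g \<in> F" for g
    using E by (simp add: gammaF_def exps_def E_def)
  show "shift (\<gamma>F F g) (lm g) = (E, snd X)" if "g \<in> F" for g
    using ge[OF that] F(1) that by (auto simp: shift_def eadd_def gammaF_def E_def divisors_def)
qed

lemma cv_spoly:
  assumes X: "X \<in> Mon" and F: "F \<subseteq> divisors X" "F \<noteq> {}" and b: "\<And>g. g \<in> F \<Longrightarrow> b g \<in> R"
  defines "Y \<equiv> (exp_XF R x n m leM F, snd X)"
  shows "cv (spoly F b) Y = (\<Sum>g\<in>F. b g * syz_entry R x n m leM F g)"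
    and "supp (spoly F b) \<subseteq> below Y"
proof -
  note E = exp_XF_facts[OF X F]
  have "cv (spoly F b) Y = (\<Sum>g\<in>F. cv (\<lambda>k. b g * mon (\<gamma>F F g) * g k) Y)"
    by (simp add: spoly_def cv_sum)
  also have "\<dots> = (\<Sum>g\<in>F. b g * syz_entry R x n m leM F g)"
  proof (rule sum.cong)
    fix g assume g: "g \<in> F"
    show "cv (\<lambda>k. b g * mon (\<gamma>F F g) * g k) Y = b g * syz_entry R x n m leM F g"
      using cv_term[OF b[OF g] E(4)[OF g], of g "lm g"] E(5)[OF g]
      by (simp add: Y_def syz_entry_def lc_eq mult.assoc)
  qed simp
  finally show "cv (spoly F b) Y = (\<Sum>g\<in>F. b g * syz_entry R x n m leM F g)" .
  have "supp (\<lambda>k. b g * mon (\<gamma>F F g) * g k) \<subseteq> below Y" if "g \<in> F" for g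
    using supp_term_lm[OF b[OF that] E(4)[OF that], of g] E(5)[OF that] F(1) that G_D[of g]
    by (auto simp: Y_def divisors_def)
  then show "supp (spoly F b) \<subseteq> below Y"
    unfolding spoly_def by (intro order_trans[OF supp_sum] UN_least)
qed

lemma syzygy_comb:
  assumes X: "X \<in> Mon" and F: "F \<subseteq> divisors X" "F \<noteq> {}"
    and r: "\<And>g. g \<in> F \<Longrightarrow> r g \<in> R"
    and syz: "(\<Sum>g\<in>F. r g * sgx (quot X g) (lc g) * cc (quot X g) (fst (lm g))) = 0"
    and gen: "finite_gen_set R B (SyzF R x n m leM F)"
    and red0: "\<And>b. b \<in> B \<Longrightarrow> red_plus R x n m leM G (spoly F b) zvec"
  shows "(\<lambda>k. \<Sum>g\<in>F. r g * mon (quot X g) * g k) \<in> comb (sbelow X)"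
proof -
  note E = exp_XF_facts[OF X F]
  define E where "E = exp_XF R x n m leM F"
  define \<delta> where "\<delta> = (\<lambda>k. fst X k - E k)"
  define Y where "Y = (E, snd X)"
  have \<delta>: "\<delta> \<in> exps n" using X by (auto simp: \<delta>_def exps_def)
  have Y: "Y \<in> Mon" using E(1) X by (auto simp: Y_def E_def)
  have XY: "shift \<delta> Y = X"
    using E(2) by (auto simp: shift_def Y_def \<delta>_def eadd_def E_def prod_eq_iff)
  have q: "eadd \<delta> (\<gamma>F F g) = quot X g" if "g \<in> F" for g
    using E(2) E(3)[OF that] by (auto simp: eadd_def quot_def \<delta>_def gammaF_def E_def)
  have "\<exists>s. s \<in> R \<and> r g * mon (quot X g) = mon \<delta> * s * mon (\<gamma>F F g)" if g: "g \<in> F" for g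
  proof -
    obtain v where v: "v \<in> units" "v * cc \<delta> (\<gamma>F F g) = 1"
      using units_inverse[OF c_ab_units[OF \<delta> E(4)[OF g]]] by metis
    have "r g * v \<in> sgx \<delta> ` R"
      using sigma_exp_bij[of \<delta>] r[OF g] units_in_R[OF v(1)] by (simp add: bij_betw_def R_closed)
    then obtain s where s: "s \<in> R" "sgx \<delta> s = r g * v" by auto
    have "mon \<delta> * s * mon (\<gamma>F F g) = r g * v * (mon \<delta> * mon (\<gamma>F F g))"
      using xmon_mult_R[OF s(1), of \<delta>] by (simp add: s(2) mult.assoc)
    also have "\<dots> = r g * (v * cc \<delta> (\<gamma>F F g)) * mon (quot X g)"
      using xmon_mult[OF \<delta> E(4)[OF g]] q[OF g] by (simp add: mult.assoc)
    finally show ?thesis using s(1) v(2) by auto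
  qed
  then obtain s where s: "\<And>g. g \<in> F \<Longrightarrow> s g \<in> R"
    "\<And>g. g \<in> F \<Longrightarrow> r g * mon (quot X g) = mon \<delta> * s g * mon (\<gamma>F F g)"
    by metis
  define s' where "s' = (\<lambda>g. if g \<in> F then s g else 0)"
  have s'R: "s' g \<in> R" for g by (simp add: s'_def s R_closed)
  define T where "T = spoly F s'"
  have sumT: "(\<lambda>k. \<Sum>g\<in>F. r g * mon (quot X g) * g k) = (\<lambda>k. 1 * mon \<delta> * T k)"
    by (auto simp: T_def spoly_def sum_distrib_left s(2) s'_def mult.assoc intro!: sum.cong)
  have "cv (\<lambda>k. \<Sum>g\<in>F. r g * mon (quot X g) * g k) X =
      (\<Sum>g\<in>F. r g * sgx (quot X g) (lc g) * cc (quot X g) (fst (lm g)))"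
    unfolding cv_sum
  proof (rule sum.cong)
    fix g assume g: "g \<in> F"
    then show "cv (\<lambda>k. r g * mon (quot X g) * g k) X = r g * sgx (quot X g) (lc g) * cc (quot X g) (fst (lm g))"
      using cv_term[OF r[OF g] quot_exps[OF X], of g g "lm g"] shift_quot[of g X] F(1) by (auto simp: lc_eq)
  qed simp
  then have "sgx \<delta> (cv T Y) * cc \<delta> E = 0"
    using syz cv_term[OF R_closed(2) \<delta>, of T Y] unfolding sumT XY by (simp add: Y_def)
  then have "sgx \<delta> (cv T Y) = 0"
    using units_mult_eq_zero[OF c_ab_units[OF \<delta>]] E(1) by (simp add: E_def)
  then have "cv T Y = 0" using sigma_exp_eq_zero[OF \<delta>] by simp
  then have "(\<Sum>g\<in>F. s' g * syz_entry R x n m leM F g) = 0"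
    using cv_spoly(1)[OF X F, of s'] s'R by (simp add: T_def Y_def E_def)
  then have "s' \<in> SyzF R x n m leM F" using s'R by (simp add: SyzF_def s'_def)
  then obtain c where c: "\<And>b. c b \<in> R" "s' = (\<lambda>g. \<Sum>b\<in>B. c b * b g)"
    using gen unfolding finite_gen_set_def by blast
  have T: "T = (\<lambda>k. \<Sum>b\<in>B. c b * mon (\<lambda>_. 0) * spoly F b k)"
  proof
    fix k
    have "T k = (\<Sum>g\<in>F. \<Sum>b\<in>B. c b * (b g * mon (\<gamma>F F g) * g k))"
      by (simp add: T_def spoly_def c(2) sum_distrib_right mult.assoc)
    also have "\<dots> = (\<Sum>b\<in>B. \<Sum>g\<in>F. c b * (b g * mon (\<gamma>F F g) * g k))" by (rule sum.swap)
    finally show "T k = (\<Sum>b\<in>B. c b * mon (\<lambda>_. 0) * spoly F b k)"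
      by (simp add: spoly_def sum_distrib_left)
  qed
  have "spoly F b \<in> comb (sbelow Y)" if b: "b \<in> B" for b
  proof -
    have bS: "b \<in> SyzF R x n m leM F" using gen b by (auto simp: finite_gen_set_def)
    then have bR: "b g \<in> R" for g by (simp add: SyzF_def)
    have "cv (spoly F b) Y = 0"
      using cv_spoly(1)[OF X F, of b] bR bS by (simp add: Y_def E_def SyzF_def)
    then have "Y \<notin> supp (spoly F b)" by (simp add: supp_iff)
    moreover have "supp (spoly F b) \<subseteq> below Y"
      using cv_spoly(2)[OF X F, of b] bR by (simp add: Y_def E_def)
    ultimately have "supp (spoly F b) \<subseteq> sbelow Y" unfolding below_eq[OF Y] by blast
    moreover have "spoly F b \<in> vecs m"
      unfolding spoly_def using F(1)
      by (intro comb_vecs[OF span_A_comb] span_A_subset_sum) (auto simp: divisors_def)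
    ultimately show ?thesis using red_plus_comb[OF red0[OF b]] downset_sbelow[OF Y] by blast
  qed
  then have "T \<in> comb (sbelow Y)"
    unfolding T by (intro comb_sum comb_term_mult[of _ "sbelow Y"] c(1) zero_exps)
      (auto simp: shift_def eadd_def)
  then show ?thesis
    unfolding sumT
  proof (rule comb_term_mult[OF _ R_closed(2) \<delta>])
    fix Z assume Z: "Z \<in> sbelow Y" "Z \<in> Mon"
    then have "leM (shift \<delta> Z) (shift \<delta> Y)" "shift \<delta> Z \<noteq> shift \<delta> Y"
      using shift_mono[OF \<delta> Z(2) Y] by (simp_all add: sbelow_def shift_inj)
    then show "shift \<delta> Z \<in> sbelow X" using shift_Mon[OF \<delta> Z(2)] by (simp add: XY sbelow_def)
  qed
qed

lemma comb_reducible: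
  assumes gen: "\<And>F. F \<subseteq> G \<Longrightarrow> F \<noteq> {} \<Longrightarrow> XF_nonzero R x n m leM F \<Longrightarrow>
      finite_gen_set R (B F) (SyzF R x n m leM F)"
    and red0: "\<And>F b. F \<subseteq> G \<Longrightarrow> F \<noteq> {} \<Longrightarrow> XF_nonzero R x n m leM F \<Longrightarrow> b \<in> B F \<Longrightarrow>
      red_plus R x n m leM G (spoly F b) zvec"
    and X: "X \<in> Mon" and f: "f \<in> comb (below X)" "f \<noteq> zvec"
  shows "reducible R x n m leM G f"
  using X f
proof (induction X arbitrary: f rule: Mon_induct)
  case (less X)
  let ?D = "divisors X"
  let ?top = "\<lambda>r k. \<Sum>g\<in>?D. r g * mon (quot X g) * g k"
  let ?c = "\<lambda>r. \<Sum>g\<in>?D. r g * sgx (quot X g) (lc g) * cc (quot X g) (fst (lm g))"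
  obtain r w where r: "\<And>g. r g \<in> R" and w: "w \<in> comb (sbelow X)" and fw: "f = (\<lambda>k. w k + ?top r k)"
    using comb_split[OF less.hyps(1) less.prems(1)] by blast
  have "supp w \<subseteq> sbelow X" using comb_supp[OF w downset_sbelow[OF less.hyps(1)]] .
  then have "X \<notin> supp w" by (auto simp: sbelow_def)
  then have "cv w X = 0" using less.hyps(1) by (auto simp: supp_iff)
  moreover have "cv (?top r) X = ?c r"
    unfolding cv_sum
  proof (rule sum.cong)
    fix g assume "g \<in> ?D"
    then show "cv (\<lambda>k. r g * mon (quot X g) * g k) X = r g * sgx (quot X g) (lc g) * cc (quot X g) (fst (lm g))"
      using cv_term[OF r quot_exps[OF less.hyps(1)], of g g g "lm g"] shift_quot[of g X] by (simp add: lc_eq)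
  qed simp
  ultimately have cfX: "cv f X = ?c r" by (simp add: fw cv_add)
  have DG: "?D \<subseteq> G" by (auto simp: divisors_def)
  show ?case
  proof (cases "?c r = 0")
    case False
    then have "X \<in> supp f" using less.hyps(1) by (auto simp: supp_iff cfX)
    moreover have "supp f \<subseteq> below X" using comb_supp[OF less.prems(1) downset_below[OF less.hyps(1)]] .
    ultimately have lmf: "lm f = X" by (intro lm_eqI) (auto simp: below_def)
    show ?thesis
      by (rule reducibleI[OF less.prems(2) DG, of r "quot X"]) (auto simp: r lmf shift_quot lc_eq[of f] cfX)
  next
    case True
    have "f \<in> comb (sbelow X)"
    proof (cases "?D = {}")
      case True
      then show ?thesis using w fw by simp
    next
      case False
      have nz: "XF_nonzero R x n m leM ?D" by (auto simp: XF_nonzero_def divisors_def)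
      have "?top r \<in> comb (sbelow X)"
        by (rule syzygy_comb[OF less.hyps(1) subset_refl False r True gen[OF DG False nz] red0[OF DG False nz]])
      then show ?thesis unfolding fw by (rule comb_add[OF w])
    qed
    then obtain Y where "Y \<in> sbelow X" "f \<in> comb (below Y)"
      using comb_below[of f "sbelow X"] less.prems(2) by blast
    then show ?thesis using less.IH less.prems(2) by blast
  qed
qed

lemma Groebner_red_plus_zero:
  assumes GB: "\<And>f. f \<in> span_A G \<Longrightarrow> f \<noteq> zvec \<Longrightarrow> reducible R x n m leM G f"
    and f: "f \<in> span_A G"
  shows "red_plus R x n m leM G f zvec"
proof (cases "f = zvec")
  case True
  then show ?thesis unfolding red_plus_def by (intro tranclp.r_into_trancl) (simp add: red_def)
next
  case False
  have vec: "f \<in> vecs m" if "f \<in> span_A G" for f using comb_vecs[OF span_A_comb[OF that]] .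
  have "\<forall>f \<in> span_A G. f \<noteq> zvec \<longrightarrow> lm f = X \<longrightarrow> red_plus R x n m leM G f zvec" if "X \<in> Mon" for X
    using that
  proof (induction X rule: Mon_induct)
    case (less X)
    show ?case
    proof (intro ballI impI)
      fix f assume f: "f \<in> span_A G" "f \<noteq> zvec" "lm f = X"
      then obtain h where h: "red R x n m leM G f h" using GB unfolding reducible_def by blast
      obtain w where w: "w \<in> comb {lm f}" "f = (\<lambda>k. h k + w k)"
        using red_decomposition(1)[OF h vec[OF f(1)] f(2)] by blast
      have "h = (\<lambda>k. f k - w k)" by (simp add: w(2))
      then have hs: "h \<in> span_A G" using span_A_diff[OF f(1) comb_span_A[OF w(1)]] by simp
      show "red_plus R x n m leM G f zvec"
      proof (cases "h = zvec")
        case True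
        then show ?thesis using h unfolding red_plus_def by blast
      next
        case False
        then have "lm h \<in> sbelow X"
          using red_decomposition(3)[OF h vec[OF f(1)] f(2)] lm_supp[OF vec[OF hs]] f(3) by blast
        then have "red_plus R x n m leM G h zvec" using less.IH hs False by blast
        then show ?thesis using h unfolding red_plus_def by (metis tranclp_into_tranclp2)
      qed
    qed
  qed
  then show ?thesis using False f lm_Mon[OF vec[OF f] False] by blast
qed

end

theorem theorem30:
  fixes R :: "'a::ring_1 set" and x :: "nat \<Rightarrow> 'a" and n m :: nat
    and leA :: "(nat \<Rightarrow> nat) \<Rightarrow> (nat \<Rightarrow> nat) \<Rightarrow> bool"
    and leM :: "(nat \<Rightarrow> nat) \<times> nat \<Rightarrow> (nat \<Rightarrow> nat) \<times> nat \<Rightarrow> bool"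
    and M G :: "(nat \<Rightarrow> 'a) set"
    and B :: "(nat \<Rightarrow> 'a) set \<Rightarrow> ((nat \<Rightarrow> 'a) \<Rightarrow> 'a) set"
  assumes "sigma_PBW R x n"
    and "quasi_commutative R x n"
    and "bijective_PBW R x n"
    and "left_noetherian R"
    and "monomial_order_A R x n leA"
    and "monomial_order_m R x n leA m leM"
    and "G \<subseteq> vecs m" and "finite G" and "zvec \<notin> G"
    and "M = span_A G" and "M \<noteq> {zvec}"
    and "\<forall>F. F \<subseteq> G \<and> F \<noteq> {} \<and> XF_nonzero R x n m leM F \<longrightarrow>
           finite_gen_set R (B F) (SyzF R x n m leM F)"
  shows "is_Groebner_basis R x n m leM M G \<longleftrightarrow>
    (\<forall>F. F \<subseteq> G \<and> F \<noteq> {} \<and> XF_nonzero R x n m leM F \<longrightarrow>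
       (\<forall>b\<in>B F. red_plus R x n m leM G
          (\<lambda>k. \<Sum>g\<in>F. b g * xmon x n (gammaF R x n m leM F g) * g k) zvec))"
    (is "_ \<longleftrightarrow> ?crit")
proof -
  interpret qc_bij_PBW_generators R x n m leA leM G
    by unfold_locales (use assms in auto)
  show ?thesis
  proof
    assume GB: "is_Groebner_basis R x n m leM M G"
    have "red_plus R x n m leM G (spoly F b) zvec" if "F \<subseteq> G" for F b
    proof (rule Groebner_red_plus_zero)
      show "spoly F b \<in> span_A G" unfolding spoly_def by (rule span_A_subset_sum[OF that])
    qed (use GB assms(10) in \<open>simp add: is_Groebner_basis_def\<close>)
    then show ?crit unfolding spoly_def by blast
  next
    assume ?crit
    then have red0: "red_plus R x n m leM G (spoly F b) zvec"
      if "F \<subseteq> G" "F \<noteq> {}" "XF_nonzero R x n m leM F" "b \<in> B F" for F b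
      using that unfolding spoly_def by blast
    have gen: "finite_gen_set R (B F) (SyzF R x n m leM F)"
      if "F \<subseteq> G" "F \<noteq> {}" "XF_nonzero R x n m leM F" for F
      using that assms(12) by blast
    have "reducible R x n m leM G f" if f: "f \<in> M" "f \<noteq> zvec" for f
    proof -
      have "f \<in> comb Mon" using span_A_comb f(1) assms(10) by simp
      then obtain X where "X \<in> Mon" "f \<in> comb (below X)"
        using comb_below[of f Mon] f(2) by blast
      then show ?thesis using comb_reducible[OF gen red0] f(2) by blast
    qed
    moreover have "G \<noteq> {}"
      using assms(10,11) by (auto simp: span_A_def zvec_def)
    moreover have "G \<subseteq> M"
      using span_A_term[of _ 1] assms(10) by auto
    ultimately show "is_Groebner_basis R x n m leM M G"
      using assms(8,9) by (simp add: is_Groebner_basis_def)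
  qed
qed

end
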